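(* Let $\mathcal{L}$ be the generator of a finite-range kinetically constrained spin model on $\mathbb{Z}$ with parameter $p\in(0,1)$ and reversible Bernoulli($p$) product measure $\mu$ (as defined in the context), and assume that $\mathrm{gap}(\mathcal{L})>0$. Then there exist $\lambda,m>0$ such that, for any probability measure $\nu$ on $\Omega=\{0,1\}^{\mathbb{Z}}$ satisfying $$\sup_{\ell}\ \max_{\omega_{-\ell},\dots,\omega_{\ell}} e^{-\lambda \ell}\,\frac{\nu(\omega_{-\ell},\dots,\omega_{\ell})}{\mu(\omega_{-\ell},\dots,\omega_{\ell})}<\infty$$ and for any local function $f$, there exists $C_f<\infty$ such that for all $t>0$ $$\int d\nu(\eta)\,\bigl|\mathbb{E}(f(\eta_t))-\mu(f)\bigr|\le C_f\, e^{-mt}.$$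
   Context: Let $\Omega=\{0,1\}^{\mathbb{Z}}$ and let $\mu=\bigotimes_{x\in\mathbb{Z}}\mu_x$ be the product measure in which each $\mu_x$ is the Bernoulli($p$) measure on $\{0,1\}$ (value $1$ with probability $p$). A function $f:\Omega\to\mathbb{R}$ is local if it depends on finitely many variables. The generator acts on local functions by $$\mathcal{L}f(\omega)=\sum_{x\in\mathbb{Z}}c_x(\omega)\,[\mu_x(f)-f(\omega)],$$ where $\mu_x(f)=\int d\mu_x(\omega_x)f(\omega)$ is the average over the variable $\omega_x$ only, all other variables being held fixed. Each constraint $c_x$ is the indicator function of some non-empty event $A_x$ that depends only on the variables $\{\omega_y:\ y\neq x,\ |x-y|\le r\}$, where $r\ge 1$ is a preassigned constant not depending on $x$. The operator $\mathcal{L}$ extends to a self-adjoint non-positive operator on $L^2(\Omega,\mu)$, and $\mathrm{gap}(\mathcal{L})$ denotes its spectral gap, i.e. the infimum of $\langle f,-\mathcal{L}f\rangle_{L^2(\mu)}/\mathrm{Var}_\mu(f)$ over non-constant $f$ in the domain. $\mathbb{E}(f(\eta_t))$ denotes the expectation of $f$ at time $t$ over the Markov process generated by $\mathcal{L}$ with initial configuration $\eta$ (a function of $\eta$). $\nu(\omega_{-\ell},\dots,\omega_\ell)$ and $\mu(\omega_{-\ell},\dots,\omega_\ell)$ denote the probabilities, under $\nu$ and $\mu$ respectively, that the configuration restricted to $\{-\ell,\dots,\ell\}$ equals $(\omega_{-\ell},\dots,\omega_\ell)$. *)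

theory Defs
  imports "HOL-Probability.Probability"
begin

section \<open>Configurations, local functions, and the Bernoulli product measure\<close>

text \<open>
  The value 1 at a site is encoded as \<^term>\<open>True\<close>. The type carries the product of the discrete
  topologies, by the library instances for functions and for \<^typ>\<open>bool\<close>.
\<close>

type_synonym config = "int \<Rightarrow> bool"

definition mu :: "real \<Rightarrow> config measure" where
  "mu p = (\<Pi>\<^sub>M x\<in>UNIV. measure_pmf (bernoulli_pmf p))"

definition Omega :: "config measure" where
  "Omega = (\<Pi>\<^sub>M x\<in>UNIV. count_space UNIV)"

definition depends_on :: "(config \<Rightarrow> 'b) \<Rightarrow> int set \<Rightarrow> bool" where
  "depends_on f S \<longleftrightarrow> (\<forall>\<omega> \<eta>. (\<forall>y\<in>S. \<omega> y = \<eta> y) \<longrightarrow> f \<omega> = f \<eta>)"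

definition local_fun :: "(config \<Rightarrow> real) \<Rightarrow> bool" where
  "local_fun f \<longleftrightarrow> (\<exists>S. finite S \<and> depends_on f S)"

definition cylinder :: "nat \<Rightarrow> config \<Rightarrow> config set" where
  "cylinder l \<omega> = {\<eta>. \<forall>x\<in>{- int l..int l}. \<eta> x = \<omega> x}"


section \<open>The generator on local functions\<close>

definition kcsm_constraints :: "nat \<Rightarrow> (int \<Rightarrow> config set) \<Rightarrow> bool" where
  "kcsm_constraints r A \<longleftrightarrow> r \<ge> 1 \<and>
     (\<forall>x. A x \<noteq> {} \<and> depends_on (\<lambda>\<omega>. \<omega> \<in> A x) {y. y \<noteq> x \<and> \<bar>x - y\<bar> \<le> int r})"

definition site_avg :: "real \<Rightarrow> int \<Rightarrow> (config \<Rightarrow> real) \<Rightarrow> config \<Rightarrow> real" where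
  "site_avg p x f \<omega> = measure_pmf.expectation (bernoulli_pmf p) (\<lambda>b. f (fun_upd \<omega> x b))"

text \<open>For local \<open>f\<close> only finitely many terms of the sum are non-zero.\<close>

definition gen :: "real \<Rightarrow> (int \<Rightarrow> config set) \<Rightarrow> (config \<Rightarrow> real) \<Rightarrow> config \<Rightarrow> real" where
  "gen p A f \<omega> = (\<Sum>\<^sub>\<infinity>x\<in>UNIV. indicator (A x) \<omega> * (site_avg p x f \<omega> - f \<omega>))"


section \<open>The self-adjoint extension and its spectral gap\<close>

definition L2_fun :: "real \<Rightarrow> (config \<Rightarrow> real) \<Rightarrow> bool" where
  "L2_fun p f \<longleftrightarrow> f \<in> borel_measurable (mu p) \<and> integrable (mu p) (\<lambda>\<omega>. (f \<omega>)\<^sup>2)"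

definition L2_tendsto :: "real \<Rightarrow> (nat \<Rightarrow> config \<Rightarrow> real) \<Rightarrow> (config \<Rightarrow> real) \<Rightarrow> bool" where
  "L2_tendsto p F f \<longleftrightarrow> (\<lambda>n. \<integral>\<omega>. (F n \<omega> - f \<omega>)\<^sup>2 \<partial>mu p) \<longlonglongrightarrow> 0"

text \<open>
  The self-adjoint extension is the closure in \<open>L\<^sup>2(\<mu>)\<close> of the generator on local functions (which are
  a core for it), given by its graph: \<open>L2_gen p A f g\<close> says that \<open>f\<close> lies in the domain and is
  mapped to \<open>g\<close>.
\<close>

definition L2_gen ::
    "real \<Rightarrow> (int \<Rightarrow> config set) \<Rightarrow> (config \<Rightarrow> real) \<Rightarrow> (config \<Rightarrow> real) \<Rightarrow> bool" where
  "L2_gen p A f g \<longleftrightarrow> L2_fun p f \<and> L2_fun p g \<and>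
     (\<exists>F. (\<forall>n. local_fun (F n)) \<and> L2_tendsto p F f \<and> L2_tendsto p (\<lambda>n. gen p A (F n)) g)"

definition var :: "real \<Rightarrow> (config \<Rightarrow> real) \<Rightarrow> real" where
  "var p f = (\<integral>\<omega>. (f \<omega> - (\<integral>\<eta>. f \<eta> \<partial>mu p))\<^sup>2 \<partial>mu p)"

text \<open>Elements of \<open>L\<^sup>2(\<mu>)\<close> are classes modulo null sets, so non-constant means not a.e. constant.\<close>

definition gap :: "real \<Rightarrow> (int \<Rightarrow> config set) \<Rightarrow> ereal" where
  "gap p A = Inf {ereal ((\<integral>\<omega>. f \<omega> * (- g \<omega>) \<partial>mu p) / var p f) | f g.
     L2_gen p A f g \<and> \<not> (\<exists>k. AE \<omega> in mu p. f \<omega> = k)}"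


section \<open>The Markov process generated by the generator\<close>

text \<open>
  A process with cadlag paths is given by a measurable space \<open>W\<close>, the laws \<open>Pr \<eta>\<close> on it for each
  initial configuration \<open>\<eta>\<close>, and the coordinates \<open>X t\<close> for times \<open>t \<ge> 0\<close>.
\<close>

definition expect ::
    "(config \<Rightarrow> 'w measure) \<Rightarrow> (real \<Rightarrow> 'w \<Rightarrow> config) \<Rightarrow> real \<Rightarrow> (config \<Rightarrow> real) \<Rightarrow> config \<Rightarrow> real" where
  "expect Pr X t f \<eta> = (\<integral>w. f (X t w) \<partial>Pr \<eta>)"

definition past :: "'w measure \<Rightarrow> (real \<Rightarrow> 'w \<Rightarrow> config) \<Rightarrow> real \<Rightarrow> 'w measure" where
  "past W X s = sigma (space W) (\<Union>u\<in>{0..s}. {X u -` B \<inter> space W | B. B \<in> sets Omega})"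

definition markov_process ::
    "'w measure \<Rightarrow> (config \<Rightarrow> 'w measure) \<Rightarrow> (real \<Rightarrow> 'w \<Rightarrow> config) \<Rightarrow> bool" where
  "markov_process W Pr X \<longleftrightarrow>
     Pr \<in> Omega \<rightarrow>\<^sub>M prob_algebra W \<and>
     (\<forall>t\<ge>0. X t \<in> W \<rightarrow>\<^sub>M Omega) \<and>
     (\<forall>w\<in>space W. (\<forall>t\<ge>0. ((\<lambda>s. X s w) \<longlongrightarrow> X t w) (at_right t)) \<and>
                   (\<forall>t>0. \<exists>l. ((\<lambda>s. X s w) \<longlongrightarrow> l) (at_left t))) \<and>
     (\<forall>\<eta>. AE w in Pr \<eta>. X 0 w = \<eta>) \<and>
     (\<forall>\<eta> s t f. s \<ge> 0 \<longrightarrow> t \<ge> 0 \<longrightarrow> f \<in> borel_measurable Omega \<longrightarrow> bounded (range f) \<longrightarrow>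
        (AE w in Pr \<eta>. real_cond_exp (Pr \<eta>) (past W X s) (\<lambda>w. f (X (s + t) w)) w
                        = expect Pr X t f (X s w)))"

text \<open>
  The generator of a Feller semigroup, and the closure of the generator on local functions, both as
  graphs of operators on the continuous functions with the supremum norm.
\<close>

definition semigroup_gen ::
    "(real \<Rightarrow> (config \<Rightarrow> real) \<Rightarrow> config \<Rightarrow> real) \<Rightarrow> (config \<Rightarrow> real) \<Rightarrow> (config \<Rightarrow> real) \<Rightarrow> bool" where
  "semigroup_gen S f g \<longleftrightarrow> continuous_on UNIV f \<and> continuous_on UNIV g \<and>
     uniform_limit UNIV (\<lambda>t \<eta>. (S t f \<eta> - f \<eta>) / t) g (at_right 0)"

definition C_gen ::
    "real \<Rightarrow> (int \<Rightarrow> config set) \<Rightarrow> (config \<Rightarrow> real) \<Rightarrow> (config \<Rightarrow> real) \<Rightarrow> bool" where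
  "C_gen p A f g \<longleftrightarrow>
     (\<exists>F. (\<forall>n. local_fun (F n)) \<and> uniform_limit UNIV F f sequentially \<and>
          uniform_limit UNIV (\<lambda>n. gen p A (F n)) g sequentially)"

definition process_generated_by ::
    "real \<Rightarrow> (int \<Rightarrow> config set) \<Rightarrow> 'w measure \<Rightarrow> (config \<Rightarrow> 'w measure) \<Rightarrow> (real \<Rightarrow> 'w \<Rightarrow> config) \<Rightarrow> bool"
  where
  "process_generated_by p A W Pr X \<longleftrightarrow>
     markov_process W Pr X \<and>
     (\<forall>t\<ge>0. \<forall>f. continuous_on UNIV f \<longrightarrow> continuous_on UNIV (expect Pr X t f)) \<and>
     (\<forall>f g. semigroup_gen (expect Pr X) f g \<longleftrightarrow> C_gen p A f g)"

end

theory Submission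
  imports Defs
begin

text \<open>
  Everything is done with local functions, by means of Euler steps \<open>T = 1 + \<epsilon> L\<^sub>n\<close>, where \<open>L\<^sub>n\<close> is
  the generator restricted to the sites \<open>\<bar>x\<bar> \<le> n\<close>; the range being \<open>r\<close>, the operator \<open>T\<close> preserves
  dependence on the window \<open>\<bar>x\<bar> \<le> n + r\<close>.

  Finite speed of propagation: if flipping site \<open>y\<close> changes \<open>f\<close> by at most \<open>D e\<^bsup>-|y|\<^esup>\<close>, then it changes
  \<open>T f\<close> by at most \<open>D (1 + \<epsilon> K) e\<^bsup>-|y|\<^esup>\<close> with \<open>K = 2 r e\<^bsup>r\<^esup>\<close>. With \<open>\<epsilon> = t / k\<close>, the boundary terms
  \<open>(L - L\<^sub>n) T\<^bsup>j\<^esup> f\<close> are thus \<open>O(e\<^bsup>K t - n\<^esup>)\<close>. For \<open>n\<close> close to \<open>(K + 2) t\<close> and \<open>k\<close> large, this makes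
  \<open>T\<^bsup>k\<^esup> f\<close> exponentially close to the semigroup at time \<open>t\<close> in the supremum norm. The gap inequality, up
  to the same boundary terms, makes the variance of \<open>T\<^bsup>k\<^esup> f\<close> decay like \<open>e\<^bsup>-2 g t\<^esup>\<close> for some \<open>g > 0\<close>.
  As \<open>T\<^bsup>k\<^esup> f\<close> sees only the window, replacing \<open>\<mu>\<close> by \<open>\<nu>\<close> costs a factor \<open>O(e\<^bsup>\<lambda> (K + 2) t\<^esup>)\<close>, which
  a small \<open>\<lambda>\<close> makes less than the decay.
\<close>

section \<open>Local functions\<close>

lemma depends_on_mono: "depends_on f S \<Longrightarrow> S \<subseteq> T \<Longrightarrow> depends_on f T"
  unfolding depends_on_def by blast

lemma depends_on_const: "depends_on (\<lambda>_. c) S"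
  unfolding depends_on_def by simp

lemma depends_onD: "depends_on f S \<Longrightarrow> (\<And>y. y \<in> S \<Longrightarrow> \<omega> y = \<eta> y) \<Longrightarrow> f \<omega> = f \<eta>"
  unfolding depends_on_def by blast

lemma depends_onI:
  "(\<And>\<omega> \<eta>. (\<And>y. y \<in> S \<Longrightarrow> \<omega> y = \<eta> y) \<Longrightarrow> f \<omega> = f \<eta>) \<Longrightarrow> depends_on f S"
  unfolding depends_on_def by blast

lemma depends_on_compose2:
  assumes "depends_on f S" "depends_on g S"
  shows "depends_on (\<lambda>\<omega>. h (f \<omega>) (g \<omega>)) S"
proof (rule depends_onI)
  fix \<omega> \<eta> :: config assume "\<And>y. y \<in> S \<Longrightarrow> \<omega> y = \<eta> y"
  then have "f \<omega> = f \<eta>" "g \<omega> = g \<eta>" using assms by (blast dest: depends_onD)+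
  then show "h (f \<omega>) (g \<omega>) = h (f \<eta>) (g \<eta>)" by simp
qed

lemma depends_on_compose: "depends_on f S \<Longrightarrow> depends_on (\<lambda>\<omega>. h (f \<omega>)) S"
  by (rule depends_on_compose2[where g = "\<lambda>_. ()" and h = "\<lambda>a _. h a"])
    (simp_all add: depends_on_const)

lemma depends_on_sum:
  fixes f :: "'a \<Rightarrow> config \<Rightarrow> real"
  assumes "\<And>i. i \<in> I \<Longrightarrow> depends_on (f i) S"
  shows "depends_on (\<lambda>\<omega>. \<Sum>i\<in>I. f i \<omega>) S"
  using assms by (intro depends_onI sum.cong) (auto dest: depends_onD)

lemma depends_on_indicator:
  "depends_on (\<lambda>\<omega>. \<omega> \<in> B) S \<Longrightarrow> depends_on (indicator B :: config \<Rightarrow> real) S"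
  using depends_on_compose[of "\<lambda>\<omega>. \<omega> \<in> B" S of_bool] by (simp add: indicator_def[abs_def])

lemma depends_on_upd: "depends_on f S \<Longrightarrow> depends_on (\<lambda>\<omega>. f (fun_upd \<omega> x b)) S"
  by (subst depends_on_def, intro allI impI, erule depends_onD) auto

lemma depends_on_upd_outside: "depends_on f S \<Longrightarrow> x \<notin> S \<Longrightarrow> f (fun_upd \<omega> x b) = f \<omega>"
  by (erule depends_onD) auto

lemma local_fun_const [simp, intro]: "local_fun (\<lambda>_. c)"
  unfolding local_fun_def by (intro exI[of _ "{}"] conjI depends_on_const) simp

lemma local_fun_compose2:
  assumes "local_fun f" "local_fun g"
  shows "local_fun (\<lambda>\<omega>. h (f \<omega>) (g \<omega>))"
proof -
  obtain S T where "finite S" "depends_on f S" "finite T" "depends_on g T"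
    using assms unfolding local_fun_def by blast
  then have "finite (S \<union> T)" "depends_on f (S \<union> T)" "depends_on g (S \<union> T)"
    using depends_on_mono[of f S "S \<union> T"] depends_on_mono[of g T "S \<union> T"] by auto
  then show ?thesis
    using depends_on_compose2[of f "S \<union> T" g h] unfolding local_fun_def by blast
qed

lemma local_fun_compose: "local_fun f \<Longrightarrow> local_fun (\<lambda>\<omega>. h (f \<omega>))"
  by (rule local_fun_compose2[where g = "\<lambda>_. 0" and h = "\<lambda>a _. h a"])
    (simp_all add: local_fun_const)

lemma local_fun_add: "local_fun f \<Longrightarrow> local_fun g \<Longrightarrow> local_fun (\<lambda>\<omega>. f \<omega> + g \<omega>)"
  and local_fun_diff: "local_fun f \<Longrightarrow> local_fun g \<Longrightarrow> local_fun (\<lambda>\<omega>. f \<omega> - g \<omega>)"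
  and local_fun_mult: "local_fun f \<Longrightarrow> local_fun g \<Longrightarrow> local_fun (\<lambda>\<omega>. f \<omega> * g \<omega>)"
  by (rule local_fun_compose2; assumption)+

lemma local_fun_power: "local_fun f \<Longrightarrow> local_fun (\<lambda>\<omega>. f \<omega> ^ n)"
  by (rule local_fun_compose)

lemma local_fun_abs: "local_fun f \<Longrightarrow> local_fun (\<lambda>\<omega>. \<bar>f \<omega>\<bar>)"
  by (rule local_fun_compose)

lemma local_fun_sum: "(\<And>i. i \<in> I \<Longrightarrow> local_fun (f i)) \<Longrightarrow> local_fun (\<lambda>\<omega>. \<Sum>i\<in>I. f i \<omega>)"
  by (induction I rule: infinite_finite_induct) (auto intro: local_fun_add)

lemma local_fun_upd: "local_fun f \<Longrightarrow> local_fun (\<lambda>\<omega>. f (fun_upd \<omega> x b))"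
  unfolding local_fun_def by (elim exE conjE, rule exI, rule conjI, assumption, rule depends_on_upd)

lemmas local_fun_intros =
  local_fun_add local_fun_diff local_fun_mult local_fun_power local_fun_abs
  local_fun_sum

section \<open>Expansion of local functions into finitely many patterns\<close>

definition pattern :: "int set \<Rightarrow> int set \<Rightarrow> config set" where
  "pattern I \<sigma> = {\<eta>. {x \<in> I. \<eta> x} = \<sigma>}"

lemma depends_on_pattern: "depends_on (indicator (pattern I \<sigma>) :: config \<Rightarrow> real) I"
  unfolding depends_on_def
proof (intro allI impI)
  fix \<omega> \<eta> :: config assume "\<forall>y\<in>I. \<omega> y = \<eta> y"
  then have "{x \<in> I. \<omega> x} = {x \<in> I. \<eta> x}" by auto
  then show "indicator (pattern I \<sigma>) \<omega> = (indicator (pattern I \<sigma>) \<eta> :: real)"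
    by (simp add: pattern_def indicator_def)
qed

text \<open>Only the pattern of \<open>\<omega>\<close> itself contributes to the sum. Coding a
  configuration on \<open>I\<close> by its set of ones makes \<open>Pow I\<close> a finite index set
  and gives each pattern the representative \<open>\<lambda>x. x \<in> \<sigma>\<close>.
  Measurability, boundedness, the uniform Euler remainder and the comparison of two measures are all
  reduced to patterns in this way.\<close>

lemma depends_on_expand:
  fixes f :: "config \<Rightarrow> real"
  assumes "depends_on f I" "finite I"
  shows "f \<omega> = (\<Sum>\<sigma>\<in>Pow I. f (\<lambda>x. x \<in> \<sigma>) * indicator (pattern I \<sigma>) \<omega>)"
proof -
  let ?s = "{x \<in> I. \<omega> x}"
  have "(\<Sum>\<sigma>\<in>Pow I. f (\<lambda>x. x \<in> \<sigma>) * indicator (pattern I \<sigma>) \<omega>) =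
        (\<Sum>\<sigma>\<in>Pow I. if \<sigma> = ?s then f (\<lambda>x. x \<in> ?s) else 0)"
    by (intro sum.cong) (auto simp: pattern_def indicator_def)
  also have "\<dots> = f (\<lambda>x. x \<in> ?s)"
    using assms(2) by (subst sum.delta) auto
  also have "\<dots> = f \<omega>"
    by (rule depends_onD[OF assms(1)]) auto
  finally show ?thesis by simp
qed

section \<open>Measurability, boundedness and integrability of local functions\<close>

lemma space_Omega [simp]: "space Omega = UNIV"
  by (simp add: Omega_def space_PiM)

lemma space_mu [simp]: "space (mu p) = UNIV"
  by (simp add: mu_def space_PiM)

lemma sets_mu: "sets (mu p) = sets Omega"
  unfolding mu_def Omega_def by (intro sets_PiM_cong) auto

lemma prob_space_mu: "prob_space (mu p)"
  unfolding mu_def by (intro prob_space_PiM measure_pmf.prob_space_axioms)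

lemma measure_mu_UNIV [simp]: "measure (mu p) UNIV = 1"
  using prob_space.prob_space[OF prob_space_mu, of p] by simp

lemma component_measurable_Omega [measurable]: "Measurable.pred Omega (\<lambda>\<eta>. \<eta> x)"
  unfolding Omega_def by measurable

lemma pattern_sets: "finite I \<Longrightarrow> pattern I \<sigma> \<in> sets Omega"
proof -
  assume "finite I"
  show ?thesis
  proof (cases "\<sigma> \<subseteq> I")
    case True
    then have "pattern I \<sigma> = {\<eta> \<in> space Omega. \<forall>x\<in>I. \<eta> x \<longleftrightarrow> x \<in> \<sigma>}"
      by (auto simp: pattern_def)
    also have "\<dots> \<in> sets Omega"
      using \<open>finite I\<close> by measurable
    finally show ?thesis .
  next
    case False
    then have "pattern I \<sigma> = {}" by (auto simp: pattern_def)
    then show ?thesis by simp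
  qed
qed

lemma local_fun_measurable:
  assumes "local_fun f"
  shows "f \<in> borel_measurable Omega"
proof -
  obtain I where I: "finite I" "depends_on f I" using assms unfolding local_fun_def by blast
  have "f = (\<lambda>\<omega>. \<Sum>\<sigma>\<in>Pow I. f (\<lambda>x. x \<in> \<sigma>) * indicator (pattern I \<sigma>) \<omega>)"
    using depends_on_expand[OF I(2,1)] by blast
  also have "\<dots> \<in> borel_measurable Omega"
    using pattern_sets[OF I(1)] by measurable
  finally show ?thesis .
qed

lemma local_fun_bounded:
  assumes "local_fun f"
  obtains B where "\<And>\<omega>. \<bar>f \<omega>\<bar> \<le> B" "0 \<le> B"
proof -
  obtain I where I: "finite I" "depends_on f I" using assms unfolding local_fun_def by blast
  have *: "\<bar>f \<omega>\<bar> \<le> (\<Sum>\<sigma>\<in>Pow I. \<bar>f (\<lambda>x. x \<in> \<sigma>)\<bar>)" for \<omega>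
    by (subst depends_on_expand[OF I(2,1)], rule order.trans[OF sum_abs], rule sum_mono)
      (auto simp: indicator_def abs_mult)
  show ?thesis by (rule that[OF *]) (simp add: sum_nonneg)
qed

lemma local_fun_integrable:
  assumes "local_fun f" "finite_measure N" "sets N = sets Omega"
  shows "integrable N f"
proof -
  obtain B where "\<And>\<omega>. \<bar>f \<omega>\<bar> \<le> B" using local_fun_bounded[OF assms(1)] by metis
  moreover have "f \<in> borel_measurable N"
    using local_fun_measurable[OF assms(1)] assms(3) by (simp cong: measurable_cong_sets)
  ultimately show ?thesis
    using assms(2) by (intro finite_measure.integrable_const_bound[where B = B]) auto
qed

lemma local_fun_integrable_mu: "local_fun f \<Longrightarrow> integrable (mu p) f"
  using prob_space_mu sets_mu prob_space.finite_measure by (blast intro: local_fun_integrable)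

section \<open>The constrained generator and its gap\<close>

locale kcsm =
  fixes p :: real and r :: nat and A :: "int \<Rightarrow> config set"
  assumes p_pos: "0 < p" and p_less_1: "p < 1"
    and constraints: "kcsm_constraints r A"
begin

definition flip_gain :: "int \<Rightarrow> (config \<Rightarrow> real) \<Rightarrow> config \<Rightarrow> real" where
  "flip_gain x f \<omega> = indicator (A x) \<omega> * (site_avg p x f \<omega> - f \<omega>)"

text \<open>This finite sum has two uses: it is the full generator when \<open>f\<close> depends
  only on \<open>I\<close> (\<open>gen_eq_genI\<close>), and the generator cut off to a box when
  \<open>I\<close> is smaller than the window of \<open>f\<close>.\<close>

definition genI :: "int set \<Rightarrow> (config \<Rightarrow> real) \<Rightarrow> config \<Rightarrow> real" where
  "genI I f \<omega> = (\<Sum>x\<in>I. flip_gain x f \<omega>)"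

lemma site_avg_eq: "site_avg p x f \<omega> = p * f (fun_upd \<omega> x True) + (1 - p) * f (fun_upd \<omega> x False)"
  unfolding site_avg_def using p_pos p_less_1 by simp

lemma local_fun_site_avg: "local_fun f \<Longrightarrow> local_fun (site_avg p x f)"
  using local_fun_add[OF local_fun_mult[OF local_fun_const[of p] local_fun_upd[of f x True]]
      local_fun_mult[OF local_fun_const[of "1 - p"] local_fun_upd[of f x False]]]
  by (simp add: site_avg_eq[abs_def])

lemma depends_on_site_avg: "depends_on f S \<Longrightarrow> depends_on (site_avg p x f) S"
  unfolding site_avg_eq[abs_def]
  by (rule depends_on_compose2[where h = "\<lambda>a b. p * a + (1 - p) * b"]; rule depends_on_upd)

lemma site_avg_outside: "depends_on f S \<Longrightarrow> x \<notin> S \<Longrightarrow> site_avg p x f \<omega> = f \<omega>"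
  by (simp add: site_avg_eq depends_on_upd_outside algebra_simps)

lemma constraint_depends_on: "depends_on (indicator (A x) :: config \<Rightarrow> real) {y. y \<noteq> x \<and> \<bar>x - y\<bar> \<le> int r}"
  using constraints unfolding kcsm_constraints_def by (intro depends_on_indicator) blast

lemma local_fun_constraint: "local_fun (indicator (A x))"
proof -
  have "finite {y. y \<noteq> x \<and> \<bar>x - y\<bar> \<le> int r}"
    by (rule finite_subset[of _ "{x - int r..x + int r}"]) auto
  then show ?thesis using constraint_depends_on local_fun_def by blast
qed

lemma constraint_upd:
  "y = x \<or> \<bar>x - y\<bar> > int r \<Longrightarrow> (indicator (A x) (fun_upd \<omega> y b) :: real) = indicator (A x) \<omega>"
  by (rule depends_on_upd_outside[OF constraint_depends_on]) auto

lemma local_fun_flip_gain: "local_fun f \<Longrightarrow> local_fun (flip_gain x f)"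
  unfolding flip_gain_def[abs_def]
  by (intro local_fun_mult local_fun_diff local_fun_constraint local_fun_site_avg)

lemma local_fun_genI: "local_fun f \<Longrightarrow> local_fun (genI I f)"
  unfolding genI_def[abs_def] by (intro local_fun_sum local_fun_flip_gain)

text \<open>Averaging never enlarges the set of relevant variables. The only new ones come from the
  constraints of the updated sites, hence the condition that \<open>S\<close> contain the
  \<open>r\<close>-neighbourhood of \<open>I\<close>.\<close>

lemma depends_on_genI:
  assumes "depends_on f S" "\<And>x y. x \<in> I \<Longrightarrow> \<bar>x - y\<bar> \<le> int r \<Longrightarrow> y \<in> S"
  shows "depends_on (genI I f) S"
  unfolding genI_def[abs_def]
proof (rule depends_on_sum)
  fix x assume "x \<in> I"
  have "depends_on (\<lambda>\<omega>. site_avg p x f \<omega> - f \<omega>) S"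
    by (rule depends_on_compose2[OF depends_on_site_avg]) fact+
  moreover have "depends_on (indicator (A x) :: config \<Rightarrow> real) S"
    by (rule depends_on_mono[OF constraint_depends_on]) (use assms(2) \<open>x \<in> I\<close> in auto)
  ultimately show "depends_on (flip_gain x f) S"
    unfolding flip_gain_def[abs_def] by (intro depends_on_compose2[where h = "(*)"])
qed

lemma flip_gain_outside: "depends_on f S \<Longrightarrow> x \<notin> S \<Longrightarrow> flip_gain x f \<omega> = 0"
  by (simp add: flip_gain_def site_avg_outside)

lemma gen_eq_genI: "depends_on f S \<Longrightarrow> finite S \<Longrightarrow> gen p A f \<omega> = genI S f \<omega>"
proof -
  assume S: "depends_on f S" "finite S"
  have "gen p A f \<omega> = (\<Sum>\<^sub>\<infinity>x\<in>UNIV. flip_gain x f \<omega>)"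
    by (simp add: gen_def flip_gain_def)
  also have "\<dots> = (\<Sum>\<^sub>\<infinity>x\<in>S. flip_gain x f \<omega>)"
    by (rule infsum_cong_neutral) (auto simp: flip_gain_outside[OF S(1)])
  also have "\<dots> = genI S f \<omega>" using S(2) by (simp add: genI_def)
  finally show ?thesis .
qed

lemma genI_linear:
  "genI I (\<lambda>\<omega>. \<Sum>\<sigma>\<in>P. c \<sigma> * e \<sigma> \<omega>) \<omega> = (\<Sum>\<sigma>\<in>P. c \<sigma> * genI I (e \<sigma>) \<omega>)"
proof -
  have "flip_gain x (\<lambda>\<omega>. \<Sum>\<sigma>\<in>P. c \<sigma> * e \<sigma> \<omega>) \<omega> = (\<Sum>\<sigma>\<in>P. c \<sigma> * flip_gain x (e \<sigma>) \<omega>)" for x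
    unfolding flip_gain_def site_avg_eq sum_distrib_left sum.distrib[symmetric] sum_subtractf[symmetric]
    by (intro sum.cong) (auto simp: algebra_simps)
  then show ?thesis
    unfolding genI_def by (simp add: sum_distrib_left) (rule sum.swap)
qed

section \<open>Invariance of the product measure and the Dirichlet form\<close>

lemma integral_site_avg:
  assumes "local_fun f"
  shows "(\<integral>\<omega>. site_avg p x f \<omega> \<partial>mu p) = (\<integral>\<omega>. f \<omega> \<partial>mu p)"
proof -
  let ?B = "measure_pmf (bernoulli_pmf p)"
  interpret M: prob_space "mu p" by (rule prob_space_mu)
  interpret B: prob_space ?B by (rule measure_pmf.prob_space_axioms)
  interpret pair_sigma_finite ?B "mu p" ..
  \<comment> \<open>Since \<open>insert x UNIV = UNIV\<close>, overwriting site \<open>x\<close> by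
    an independent Bernoulli variable reproduces \<open>mu p\<close> itself. The lemma then follows
    by Fubini.\<close>
  have distr: "distr (?B \<Otimes>\<^sub>M mu p) (mu p) (\<lambda>(b, \<omega>). fun_upd \<omega> x b) = mu p"
    using distr_pair_PiM_eq_PiM[of UNIV "\<lambda>_. ?B" x]
    by (simp add: mu_def measure_pmf.prob_space_axioms)
  have upd: "(\<lambda>(b, \<omega>). fun_upd \<omega> x b) \<in> ?B \<Otimes>\<^sub>M mu p \<rightarrow>\<^sub>M mu p"
  proof -
    have "(\<lambda>(\<omega>, b). fun_upd \<omega> x b) \<in> mu p \<Otimes>\<^sub>M ?B \<rightarrow>\<^sub>M mu p"
      unfolding mu_def using measurable_add_dim[of x UNIV "\<lambda>_. ?B"] by simp
    then show ?thesis
      using measurable_compose[OF measurable_pair_swap', of "\<lambda>(\<omega>, b). fun_upd \<omega> x b" "mu p" ?B]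
      by (simp add: case_prod_beta)
  qed
  have meas: "f \<in> borel_measurable (mu p)"
    using local_fun_measurable[OF assms] sets_mu by (simp cong: measurable_cong_sets)
  obtain C where C: "\<And>\<omega>. \<bar>f \<omega>\<bar> \<le> C" using local_fun_bounded[OF assms] by metis
  interpret BM: prob_space "?B \<Otimes>\<^sub>M mu p"
    by (intro prob_space_pair measure_pmf.prob_space_axioms prob_space_mu)
  have int: "integrable (?B \<Otimes>\<^sub>M mu p) (\<lambda>(b, \<omega>). f (fun_upd \<omega> x b))"
    using measurable_compose[OF upd meas]
    by (intro BM.integrable_const_bound[where B = C]) (auto simp: C case_prod_beta)
  have "(\<integral>\<omega>. f \<omega> \<partial>mu p) = (\<integral>z. f (case z of (b, \<omega>) \<Rightarrow> fun_upd \<omega> x b) \<partial>(?B \<Otimes>\<^sub>M mu p))"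
    by (subst distr[symmetric], rule integral_distr[OF upd meas])
  also have "\<dots> = (\<integral>(b, \<omega>). f (fun_upd \<omega> x b) \<partial>(?B \<Otimes>\<^sub>M mu p))"
    by (simp add: case_prod_beta')
  also have "\<dots> = (\<integral>\<omega>. (\<integral>b. f (fun_upd \<omega> x b) \<partial>?B) \<partial>mu p)"
    using integral_snd[OF int] by simp
  finally show ?thesis by (simp add: site_avg_def)
qed

text \<open>The constraint does not look at site \<open>x\<close>, so the average of
  \<open>flip_gain x f\<close> over that site is already zero.\<close>

lemma integral_flip_gain:
  assumes "local_fun f"
  shows "(\<integral>\<omega>. flip_gain x f \<omega> \<partial>mu p) = 0"
proof -
  have "site_avg p x (flip_gain x f) \<omega> = 0" for \<omega>
    by (simp add: site_avg_eq flip_gain_def constraint_upd algebra_simps)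
  then show ?thesis
    using integral_site_avg[OF local_fun_flip_gain[OF assms, of x], of x] by simp
qed

text \<open>Write \<open>f\<close> as its average at \<open>x\<close> minus the difference of the
  two. The average is constant in the variable at \<open>x\<close> and so integrates to zero against
  \<open>flip_gain x f\<close>; the difference gives the square, because the constraint takes only
  the values 0 and 1.\<close>

lemma integral_mult_flip_gain:
  assumes "local_fun f"
  shows "(\<integral>\<omega>. f \<omega> * flip_gain x f \<omega> \<partial>mu p) = - (\<integral>\<omega>. (flip_gain x f \<omega>)\<^sup>2 \<partial>mu p)"
proof -
  let ?h = "\<lambda>\<omega>. site_avg p x f \<omega> * flip_gain x f \<omega>"
  have "site_avg p x ?h \<omega> = 0" for \<omega>
    by (simp add: site_avg_eq flip_gain_def constraint_upd algebra_simps)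
  moreover have h: "local_fun ?h"
    by (intro local_fun_mult local_fun_site_avg local_fun_flip_gain assms)
  ultimately have 0: "(\<integral>\<omega>. ?h \<omega> \<partial>mu p) = 0"
    using integral_site_avg[OF h, of x] by simp
  have "f \<omega> * flip_gain x f \<omega> = ?h \<omega> - (flip_gain x f \<omega>)\<^sup>2" for \<omega>
    by (simp add: flip_gain_def power2_eq_square indicator_def algebra_simps)
  then have "(\<integral>\<omega>. f \<omega> * flip_gain x f \<omega> \<partial>mu p) =
      (\<integral>\<omega>. ?h \<omega> \<partial>mu p) - (\<integral>\<omega>. (flip_gain x f \<omega>)\<^sup>2 \<partial>mu p)"
    using h local_fun_power[OF local_fun_flip_gain[OF assms]]
    by (simp add: Bochner_Integration.integral_diff local_fun_integrable_mu)
  then show ?thesis using 0 by simp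
qed

lemma integral_genI: "local_fun f \<Longrightarrow> (\<integral>\<omega>. genI I f \<omega> \<partial>mu p) = 0"
  unfolding genI_def
  by (subst Bochner_Integration.integral_sum)
    (auto simp: integral_flip_gain intro: local_fun_integrable_mu local_fun_flip_gain)

lemma integral_mult_genI:
  assumes "local_fun f"
  shows "(\<integral>\<omega>. f \<omega> * genI I f \<omega> \<partial>mu p) = - (\<Sum>x\<in>I. \<integral>\<omega>. (flip_gain x f \<omega>)\<^sup>2 \<partial>mu p)"
proof -
  have "(\<integral>\<omega>. f \<omega> * genI I f \<omega> \<partial>mu p) = (\<Sum>x\<in>I. \<integral>\<omega>. f \<omega> * flip_gain x f \<omega> \<partial>mu p)"
    unfolding genI_def sum_distrib_left
    by (intro Bochner_Integration.integral_sum local_fun_integrable_mu local_fun_mult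
        local_fun_flip_gain assms)
  then show ?thesis by (simp add: integral_mult_flip_gain[OF assms] sum_negf)
qed

text \<open>The Poincare inequality in terms of single-site energies. The infimum in
  \<open>gap\<close> ranges only over functions that are not a.e. constant; for the others the
  variance, and with it the left side, is zero.\<close>

lemma spectral_gap_local:
  assumes f: "local_fun f" and S: "depends_on f S" "finite S" and g: "ereal g \<le> gap p A"
  shows "g * var p f \<le> (\<Sum>x\<in>S. \<integral>\<omega>. (flip_gain x f \<omega>)\<^sup>2 \<partial>mu p)"
proof -
  interpret M: prob_space "mu p" by (rule prob_space_mu)
  have gen: "gen p A f = genI S f" using gen_eq_genI[OF S] by blast
  have loc: "L2_fun p h" if "local_fun h" for h
    using local_fun_integrable_mu[OF that, of p]
      local_fun_integrable_mu[OF local_fun_power[OF that, of 2], of p]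
    by (auto simp: L2_fun_def)
  have energy: "(\<integral>\<omega>. f \<omega> * (- gen p A f \<omega>) \<partial>mu p) = (\<Sum>x\<in>S. \<integral>\<omega>. (flip_gain x f \<omega>)\<^sup>2 \<partial>mu p)"
    using integral_mult_genI[OF f, of S] by (simp add: gen)
  \<comment> \<open>A local function is its own approximating sequence, so it lies in the domain of
    the closure.\<close>
  have dom: "L2_gen p A f (gen p A f)"
    unfolding L2_gen_def L2_tendsto_def
    using loc[OF f] loc[OF local_fun_genI[OF f, of S]] f
    by (auto simp: gen intro!: exI[of _ "\<lambda>_. f"])
  let ?m = "\<integral>\<eta>. f \<eta> \<partial>mu p"
  have lsq: "local_fun (\<lambda>\<omega>. (f \<omega> - ?m)\<^sup>2)"
    by (intro local_fun_power local_fun_diff f local_fun_const)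
  have var0: "var p f = 0 \<longleftrightarrow> (AE \<omega> in mu p. f \<omega> = ?m)"
    unfolding var_def
    by (subst integral_nonneg_eq_0_iff_AE[OF local_fun_integrable_mu[OF lsq]]) auto
  have var_nonneg: "0 \<le> var p f" by (simp add: var_def)
  show ?thesis
  proof (cases "var p f = 0")
    case True
    then show ?thesis by (simp add: sum_nonneg)
  next
    case False
    have nc: "\<not> (\<exists>k. AE \<omega> in mu p. f \<omega> = k)"
    proof
      assume "\<exists>k. AE \<omega> in mu p. f \<omega> = k"
      then obtain k where k: "AE \<omega> in mu p. f \<omega> = k" by blast
      have "?m = (\<integral>\<omega>. k \<partial>mu p)"
        using k local_fun_integrable_mu[OF f] by (intro integral_cong_AE) auto
      then have "?m = k" by simp
      then show False using False var0 k by simp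
    qed
    have gap_le: "gap p A \<le> ereal ((\<integral>\<omega>. f \<omega> * (- gen p A f \<omega>) \<partial>mu p) / var p f)"
      unfolding gap_def
      by (rule Inf_lower, rule CollectI, rule exI[of _ f], rule exI[of _ "gen p A f"])
        (rule conjI[OF refl conjI[OF dom nc]])
    have "g \<le> (\<Sum>x\<in>S. \<integral>\<omega>. (flip_gain x f \<omega>)\<^sup>2 \<partial>mu p) / var p f"
      using order.trans[OF g gap_le] unfolding energy ereal_less_eq(3) .
    then show ?thesis using False var_nonneg by (simp add: pos_le_divide_eq)
  qed
qed

section \<open>Euler steps\<close>

definition step :: "nat \<Rightarrow> real \<Rightarrow> (config \<Rightarrow> real) \<Rightarrow> config \<Rightarrow> real" where
  "step n \<epsilon> f \<omega> = f \<omega> + \<epsilon> * genI {- int n..int n} f \<omega>"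

section \<open>Exponentially weighted oscillations and finite speed of propagation\<close>

definition osc_le :: "(config \<Rightarrow> real) \<Rightarrow> real \<Rightarrow> bool" where
  "osc_le f D \<longleftrightarrow> (\<forall>\<omega> y b. \<bar>f (fun_upd \<omega> y b) - f \<omega>\<bar> \<le> D * exp (- real_of_int \<bar>y\<bar>))"

lemma osc_leD: "osc_le f D \<Longrightarrow> \<bar>f (fun_upd \<omega> y b) - f \<omega>\<bar> \<le> D * exp (- real_of_int \<bar>y\<bar>)"
  unfolding osc_le_def by blast

lemma osc_le_nonneg: "osc_le f D \<Longrightarrow> 0 \<le> D"
  using osc_leD[of f D "\<lambda>_. True" 0 True] by simp

text \<open>Outside the window nothing changes; inside it the weight is at least
  \<open>exp (- n)\<close>, and the factor \<open>exp n\<close> compensates for that.\<close>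

lemma osc_le_local:
  assumes "depends_on f {- int n..int n}" "\<And>\<omega>. \<bar>f \<omega>\<bar> \<le> B"
  shows "osc_le f (2 * B * exp (real n))"
  unfolding osc_le_def
proof (intro allI)
  fix \<omega> :: config and y :: int and b
  have B: "0 \<le> B" using assms(2)[of "\<lambda>_. True"] by linarith
  show "\<bar>f (fun_upd \<omega> y b) - f \<omega>\<bar> \<le> 2 * B * exp (real n) * exp (- real_of_int \<bar>y\<bar>)"
  proof (cases "\<bar>y\<bar> \<le> int n")
    case True
    then have "1 \<le> exp (real n - real_of_int \<bar>y\<bar>)" by simp
    then have "2 * B * 1 \<le> 2 * B * exp (real n - real_of_int \<bar>y\<bar>)"
      using B by (intro mult_left_mono) auto
    moreover have "\<bar>f (fun_upd \<omega> y b) - f \<omega>\<bar> \<le> 2 * B"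
      using assms(2)[of "fun_upd \<omega> y b"] assms(2)[of \<omega>] by linarith
    moreover have "2 * B * exp (real n) * exp (- real_of_int \<bar>y\<bar>) = 2 * B * exp (real n - real_of_int \<bar>y\<bar>)"
      by (simp add: exp_diff exp_minus field_simps)
    ultimately show ?thesis by linarith
  next
    case False
    then have "y \<notin> {- int n..int n}" by auto
    then show ?thesis using B by (simp add: depends_on_upd_outside[OF assms(1)])
  qed
qed

lemma abs_convex_le:
  fixes a b c :: real
  assumes "\<bar>a\<bar> \<le> c" "\<bar>b\<bar> \<le> c"
  shows "\<bar>p * a + (1 - p) * b\<bar> \<le> c"
proof -
  have "\<bar>p * a + (1 - p) * b\<bar> \<le> p * \<bar>a\<bar> + (1 - p) * \<bar>b\<bar>"
    using p_pos p_less_1 by (intro order.trans[OF abs_triangle_ineq]) (auto simp: abs_mult)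
  also have "\<dots> \<le> p * c + (1 - p) * c"
    using p_pos p_less_1 assms by (intro add_mono mult_left_mono) auto
  finally show ?thesis by (simp add: algebra_simps)
qed

lemma abs_site_avg_le:
  assumes "\<bar>f (fun_upd \<omega> x True) - a\<bar> \<le> c" "\<bar>f (fun_upd \<omega> x False) - a\<bar> \<le> c"
  shows "\<bar>site_avg p x f \<omega> - a\<bar> \<le> c"
proof -
  have "site_avg p x f \<omega> - a = p * (f (fun_upd \<omega> x True) - a) + (1 - p) * (f (fun_upd \<omega> x False) - a)"
    by (simp add: site_avg_eq algebra_simps)
  then show ?thesis using abs_convex_le[OF assms] by simp
qed

lemma site_avg_osc: "osc_le f D \<Longrightarrow> \<bar>site_avg p x f \<omega> - f \<omega>\<bar> \<le> D * exp (- real_of_int \<bar>x\<bar>)"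
  by (intro abs_site_avg_le osc_leD)

lemma flip_gain_osc: "osc_le f D \<Longrightarrow> \<bar>flip_gain x f \<omega>\<bar> \<le> D * exp (- real_of_int \<bar>x\<bar>)"
  using site_avg_osc[of f D x \<omega>] osc_le_nonneg[of f D]
  by (simp add: flip_gain_def abs_mult indicator_def)

text \<open>Updates at different sites commute, so the difference is a convex combination of
  increments of \<open>f\<close> at \<open>y\<close>.\<close>

lemma site_avg_upd_osc:
  assumes "osc_le f D" "x \<noteq> y"
  shows "\<bar>site_avg p x f (fun_upd \<omega> y b) - site_avg p x f \<omega>\<bar> \<le> D * exp (- real_of_int \<bar>y\<bar>)"
proof -
  have twist: "fun_upd (fun_upd \<omega> y b) x c = fun_upd (fun_upd \<omega> x c) y b" for c
    using assms(2) by (simp add: fun_upd_twist)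
  have "site_avg p x f (fun_upd \<omega> y b) - site_avg p x f \<omega> =
      p * (f (fun_upd (fun_upd \<omega> x True) y b) - f (fun_upd \<omega> x True)) +
      (1 - p) * (f (fun_upd (fun_upd \<omega> x False) y b) - f (fun_upd \<omega> x False))"
    by (simp only: site_avg_eq twist) (simp add: algebra_simps)
  then show ?thesis
    using abs_convex_le[OF osc_leD[OF assms(1), of "fun_upd \<omega> x True" y b]
        osc_leD[OF assms(1), of "fun_upd \<omega> x False" y b]] by simp
qed

text \<open>Updating \<open>x\<close> can only spread the discrepancy at \<open>y\<close> if \<open>y\<close> is in the range of \<open>c\<^sub>x\<close>.\<close>

lemma update_osc:
  fixes x y :: int
  assumes f: "osc_le f D"
  defines "h \<equiv> \<lambda>\<omega>. f \<omega> + flip_gain x f \<omega>"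
  shows "\<bar>h (fun_upd \<omega> y b) - h \<omega>\<bar> \<le> D * exp (- real_of_int \<bar>y\<bar>) +
    (if x \<noteq> y \<and> \<bar>x - y\<bar> \<le> int r then D * exp (- real_of_int \<bar>x\<bar>) else 0)"
proof -
  let ?\<omega> = "fun_upd \<omega> y b"
  have h: "h \<eta> = (if \<eta> \<in> A x then site_avg p x f \<eta> else f \<eta>)" for \<eta>
    by (simp add: h_def flip_gain_def)
  have Dx: "0 \<le> D * exp (- real_of_int \<bar>x\<bar>)" and Dy: "0 \<le> D * exp (- real_of_int \<bar>y\<bar>)"
    using osc_le_nonneg[OF f] by auto
  note fy = osc_leD[OF f, of \<omega> y b]
  have A: "?\<omega> \<in> A x \<longleftrightarrow> \<omega> \<in> A x" if "y = x \<or> \<bar>x - y\<bar> > int r"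
    using constraint_upd[OF that, of \<omega> b] by (auto simp: indicator_def split: if_splits)
  show ?thesis
  proof (cases "x = y")
    \<comment> \<open>The average at \<open>x\<close> forgets the flipped value, and the constraint
      does not see it.\<close>
    case True
    then have "site_avg p x f ?\<omega> = site_avg p x f \<omega>" by (simp add: site_avg_eq)
    then show ?thesis using A True fy Dy by (simp add: h)
  next
    case False
    note avg = site_avg_upd_osc[OF f False, of \<omega> b]
    show ?thesis
    proof (cases "\<bar>x - y\<bar> \<le> int r")
      \<comment> \<open>Flipping \<open>y\<close> may now switch the constraint at \<open>x\<close>,
        so that an average on one side is compared with \<open>f\<close> on the other. Passing
        between the two costs the extra \<open>?ex\<close>.\<close>
      case True
      let ?ex = "D * exp (- real_of_int \<bar>x\<bar>)" and ?ey = "D * exp (- real_of_int \<bar>y\<bar>)"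
      have tri: "\<bar>u - w\<bar> \<le> a + c" if "\<bar>u - v\<bar> \<le> a" "\<bar>v - w\<bar> \<le> c" for u v w a c :: real
        using that by linarith
      have "\<bar>f ?\<omega> - site_avg p x f \<omega>\<bar> \<le> ?ey + ?ex"
        using tri[OF fy] site_avg_osc[OF f, of x \<omega>] by (simp only: abs_minus_commute)
      moreover have "\<bar>site_avg p x f ?\<omega> - f \<omega>\<bar> \<le> ?ey + ?ex"
        using tri[OF site_avg_osc[OF f, of x ?\<omega>] fy] by (simp only: add.commute)
      moreover have "\<bar>f ?\<omega> - f \<omega>\<bar> \<le> ?ey + ?ex" "\<bar>site_avg p x f ?\<omega> - site_avg p x f \<omega>\<bar> \<le> ?ey + ?ex"
        using add_increasing2[OF Dx fy] add_increasing2[OF Dx avg] by simp_all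
      ultimately show ?thesis using True False by (simp add: h)
    next
      case far: False
      then show ?thesis using A False fy avg by (simp add: h)
    qed
  qed
qed

definition speed :: real where
  "speed = 2 * real r * exp (real r)"

lemma speed_nonneg: "0 \<le> speed"
  by (simp add: speed_def)

text \<open>There are \<open>2 * r\<close> sites \<open>x \<noteq> y\<close> within range of
  \<open>y\<close>, and at each of them the weight exceeds that of \<open>y\<close> by a factor of
  at most \<open>exp r\<close>. This is where the constant \<open>speed\<close> comes from.\<close>

lemma range_sum_le:
  assumes "0 \<le> D" "finite I"
  shows "(\<Sum>x\<in>I. if x \<noteq> y \<and> \<bar>x - y\<bar> \<le> int r then D * exp (- real_of_int \<bar>x\<bar>) else 0)
    \<le> speed * (D * exp (- real_of_int \<bar>y\<bar>))"
proof -
  let ?R = "{y - int r..y + int r} - {y}"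
  let ?e = "D * exp (real r - real_of_int \<bar>y\<bar>)"
  have "(\<Sum>x\<in>I. if x \<noteq> y \<and> \<bar>x - y\<bar> \<le> int r then D * exp (- real_of_int \<bar>x\<bar>) else 0)
      \<le> (\<Sum>x\<in>I. if x \<in> ?R then ?e else 0)"
  proof (rule sum_mono)
    fix x
    have "D * exp (- real_of_int \<bar>x\<bar>) \<le> ?e" if "\<bar>x - y\<bar> \<le> int r"
    proof -
      have "- real_of_int \<bar>x\<bar> \<le> real r - real_of_int \<bar>y\<bar>" using that by linarith
      then show ?thesis using assms(1) by (intro mult_left_mono) auto
    qed
    then show "(if x \<noteq> y \<and> \<bar>x - y\<bar> \<le> int r then D * exp (- real_of_int \<bar>x\<bar>) else 0)
        \<le> (if x \<in> ?R then ?e else 0)"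
      by auto
  qed
  also have "\<dots> = (\<Sum>x\<in>I \<inter> ?R. ?e)"
    by (rule sum.inter_restrict[OF assms(2), symmetric])
  also have "\<dots> \<le> (\<Sum>x\<in>?R. ?e)"
    using assms(1) by (intro sum_mono2) auto
  also have "\<dots> = 2 * real r * ?e"
    by (simp add: card_Diff_singleton)
  also have "\<dots> = speed * (D * exp (- real_of_int \<bar>y\<bar>))"
    by (simp add: speed_def exp_diff exp_minus field_simps)
  finally show ?thesis .
qed

text \<open>For \<open>\<epsilon> * (2 * n + 1) \<le> 1\<close> this is a convex combination of
  \<open>f\<close> and of its constrained updates at the \<open>2 * n + 1\<close> sites. Estimates
  for a single update therefore pass to the whole step without any growth in
  \<open>n\<close>.\<close>

lemma step_eq_convex:
  "step n \<epsilon> f \<omega> = (1 - \<epsilon> * real (2 * n + 1)) * f \<omega> +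
    \<epsilon> * (\<Sum>x\<in>{- int n..int n}. f \<omega> + flip_gain x f \<omega>)"
proof -
  have "nat (int n + int n + 1) = 2 * n + 1" by simp
  then show ?thesis by (simp add: step_def genI_def sum.distrib algebra_simps)
qed

text \<open>In the convex combination the contributions proportional to \<open>2 * n + 1\<close>
  cancel. Only the spreading through the constraints remains, so the growth rate does not depend on
  the size of the box.\<close>

lemma step_osc:
  assumes f: "osc_le f D" and \<epsilon>: "0 \<le> \<epsilon>" "\<epsilon> * real (2 * n + 1) \<le> 1"
  shows "osc_le (step n \<epsilon> f) (D * (1 + \<epsilon> * speed))"
  unfolding osc_le_def
proof (intro allI)
  fix \<omega> :: config and y :: int and b
  let ?\<omega> = "fun_upd \<omega> y b" and ?I = "{- int n..int n}"
  let ?d = "D * exp (- real_of_int \<bar>y\<bar>)"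
  let ?h = "\<lambda>x \<omega>. f \<omega> + flip_gain x f \<omega>"
  have card: "real (card ?I) = real (2 * n + 1)" by simp
  have sum: "\<bar>\<Sum>x\<in>?I. ?h x ?\<omega> - ?h x \<omega>\<bar> \<le> (\<Sum>x\<in>?I. ?d +
      (if x \<noteq> y \<and> \<bar>x - y\<bar> \<le> int r then D * exp (- real_of_int \<bar>x\<bar>) else 0))"
    by (rule order.trans[OF sum_abs]) (rule sum_mono, rule update_osc[OF f])
  let ?S = "\<Sum>x\<in>?I. ?h x ?\<omega> - ?h x \<omega>"
  have eq: "step n \<epsilon> f ?\<omega> - step n \<epsilon> f \<omega> =
      (1 - \<epsilon> * real (2 * n + 1)) * (f ?\<omega> - f \<omega>) + \<epsilon> * ?S"
    unfolding step_eq_convex sum_subtractf by (simp add: algebra_simps)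
  have "\<bar>(1 - \<epsilon> * real (2 * n + 1)) * (f ?\<omega> - f \<omega>)\<bar> \<le> (1 - \<epsilon> * real (2 * n + 1)) * ?d"
    using \<epsilon> mult_left_mono[OF osc_leD[OF f, of \<omega> y b], of "1 - \<epsilon> * real (2 * n + 1)"]
    by (simp add: abs_mult)
  moreover have "\<bar>?S\<bar> \<le> real (2 * n + 1) * ?d + speed * ?d"
    using sum range_sum_le[OF osc_le_nonneg[OF f], of ?I y]
    unfolding sum.distrib sum_constant card by simp
  then have "\<bar>\<epsilon> * ?S\<bar> \<le> \<epsilon> * (real (2 * n + 1) * ?d + speed * ?d)"
    using \<epsilon>(1) by (simp add: abs_mult mult_left_mono)
  ultimately have "\<bar>step n \<epsilon> f ?\<omega> - step n \<epsilon> f \<omega>\<bar> \<le>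
      (1 - \<epsilon> * real (2 * n + 1)) * ?d + \<epsilon> * (real (2 * n + 1) * ?d + speed * ?d)"
    unfolding eq by (rule order.trans[OF abs_triangle_ineq add_mono])
  also have "\<dots> = D * (1 + \<epsilon> * speed) * exp (- real_of_int \<bar>y\<bar>)"
    by (simp add: algebra_simps)
  finally show "\<bar>step n \<epsilon> f ?\<omega> - step n \<epsilon> f \<omega>\<bar> \<le> D * (1 + \<epsilon> * speed) * exp (- real_of_int \<bar>y\<bar>)" .
qed

lemma step_bounded:
  assumes f: "\<And>\<omega>. \<bar>f \<omega>\<bar> \<le> B" and \<epsilon>: "0 \<le> \<epsilon>" "\<epsilon> * real (2 * n + 1) \<le> 1"
  shows "\<bar>step n \<epsilon> f \<omega>\<bar> \<le> B"
proof -
  let ?I = "{- int n..int n}"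
  have card: "real (card ?I) = real (2 * n + 1)" by simp
  let ?S = "\<Sum>x\<in>?I. f \<omega> + flip_gain x f \<omega>"
  have "\<bar>f \<omega> + flip_gain x f \<omega>\<bar> \<le> B" for x
    using f[of \<omega>] abs_site_avg_le[of f \<omega> x 0 B] f by (simp add: flip_gain_def indicator_def)
  then have "\<bar>?S\<bar> \<le> (\<Sum>x\<in>?I. B)"
    by (intro order.trans[OF sum_abs] sum_mono)
  then have "\<bar>?S\<bar> \<le> real (2 * n + 1) * B" unfolding sum_constant card .
  then have "\<bar>\<epsilon> * ?S\<bar> \<le> \<epsilon> * (real (2 * n + 1) * B)"
    using \<epsilon>(1) by (simp add: abs_mult mult_left_mono)
  moreover have "\<bar>(1 - \<epsilon> * real (2 * n + 1)) * f \<omega>\<bar> \<le> (1 - \<epsilon> * real (2 * n + 1)) * B"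
    using \<epsilon> mult_left_mono[OF f[of \<omega>], of "1 - \<epsilon> * real (2 * n + 1)"] by (simp add: abs_mult)
  ultimately have "\<bar>step n \<epsilon> f \<omega>\<bar> \<le> (1 - \<epsilon> * real (2 * n + 1)) * B + \<epsilon> * (real (2 * n + 1) * B)"
    unfolding step_eq_convex by (intro order.trans[OF abs_triangle_ineq add_mono])
  then show ?thesis by (simp add: algebra_simps)
qed

section \<open>Window, mean and boundary terms of one step\<close>

lemma step_local: "local_fun f \<Longrightarrow> local_fun (step n \<epsilon> f)"
  unfolding step_def[abs_def]
  by (intro local_fun_add local_fun_mult local_fun_const local_fun_genI)

text \<open>Only sites up to distance \<open>n\<close> are updated, and their constraints reach no
  further than \<open>n + r\<close>. The window therefore stays fixed under iteration.\<close>

lemma step_depends_on: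
  assumes "depends_on f {- int (n + r)..int (n + r)}"
  shows "depends_on (step n \<epsilon> f) {- int (n + r)..int (n + r)}"
  unfolding step_def[abs_def]
  by (rule depends_on_compose2[where h = "\<lambda>a b. a + \<epsilon> * b", OF assms depends_on_genI[OF assms]]) auto

lemma integral_step: "local_fun f \<Longrightarrow> (\<integral>\<omega>. step n \<epsilon> f \<omega> \<partial>mu p) = (\<integral>\<omega>. f \<omega> \<partial>mu p)"
  unfolding step_def
  by (simp add: local_fun_integrable_mu local_fun_genI integral_genI)

lemma abs_genI_le:
  assumes "\<And>\<omega>. \<bar>f \<omega>\<bar> \<le> B"
  shows "\<bar>genI I f \<omega>\<bar> \<le> real (card I) * (2 * B)"
proof -
  have "0 \<le> B" using assms[of \<omega>] by linarith
  moreover have "\<bar>site_avg p x f \<omega> - f \<omega>\<bar> \<le> 2 * B" for x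
  proof -
    have "\<bar>site_avg p x f \<omega>\<bar> \<le> B"
      using abs_site_avg_le[of f \<omega> x 0 B] assms by simp
    then show ?thesis using assms[of \<omega>] by linarith
  qed
  ultimately have "\<bar>flip_gain x f \<omega>\<bar> \<le> 2 * B" for x
    by (simp add: flip_gain_def indicator_def)
  then have "\<bar>genI I f \<omega>\<bar> \<le> (\<Sum>x\<in>I. 2 * B)"
    unfolding genI_def by (intro order.trans[OF sum_abs] sum_mono)
  then show ?thesis by simp
qed

lemma boundary_card: "real (card ({- int (n + r)..int (n + r)} - {- int n..int n})) = 2 * real r"
  by (subst card_Diff_subset) auto

lemma boundary_flip_gain:
  assumes "osc_le f D" "x \<in> {- int (n + r)..int (n + r)} - {- int n..int n}"
  shows "\<bar>flip_gain x f \<omega>\<bar> \<le> D * exp (- real n)"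
proof -
  have "- real_of_int \<bar>x\<bar> \<le> - real n" using assms(2) by auto
  then have "D * exp (- real_of_int \<bar>x\<bar>) \<le> D * exp (- real n)"
    using osc_le_nonneg[OF assms(1)] by (intro mult_left_mono) auto
  then show ?thesis using flip_gain_osc[OF assms(1), of x \<omega>] by linarith
qed

text \<open>On the window the full generator is the sum over all its sites, so the difference lives
  on the shell of \<open>2 * r\<close> boundary sites, where the weight is at most
  \<open>exp (- n)\<close>.\<close>

lemma gen_minus_genI_le:
  assumes f: "osc_le f D" "depends_on f {- int (n + r)..int (n + r)}"
  shows "\<bar>gen p A f \<omega> - genI {- int n..int n} f \<omega>\<bar> \<le> 2 * real r * (D * exp (- real n))"
proof -
  let ?M = "{- int (n + r)..int (n + r)}" and ?N = "{- int n..int n}"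
  have eq: "gen p A f \<omega> - genI ?N f \<omega> = (\<Sum>x\<in>?M - ?N. flip_gain x f \<omega>)"
    unfolding gen_eq_genI[OF f(2) finite_atLeastAtMost_int] genI_def
    by (subst sum_diff) auto
  have "\<bar>\<Sum>x\<in>?M - ?N. flip_gain x f \<omega>\<bar> \<le> (\<Sum>x\<in>?M - ?N. D * exp (- real n))"
    by (intro order.trans[OF sum_abs] sum_mono boundary_flip_gain[OF f(1)])
  then show ?thesis unfolding eq sum_constant boundary_card .
qed

text \<open>Expand the square of \<open>f\<close> minus its mean plus \<open>\<epsilon>\<close>
  times the cut-off generator. The mean of the generator term is zero, the cross term is the
  Dirichlet form and is handled by the gap, and the second-order term is bounded crudely, since its
  extra factor \<open>\<epsilon>\<close> will be made small.\<close>

lemma var_step_le: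
  assumes f: "osc_le f D" "depends_on f {- int (n + r)..int (n + r)}" "\<And>\<omega>. \<bar>f \<omega>\<bar> \<le> B"
    and g: "ereal g \<le> gap p A" and \<epsilon>: "0 \<le> \<epsilon>"
  shows "var p (step n \<epsilon> f) \<le> (1 - 2 * \<epsilon> * g) * var p f +
    \<epsilon> * (4 * real r * (D * exp (- real n))\<^sup>2 + \<epsilon> * (real (2 * n + 1) * (2 * B))\<^sup>2)"
proof -
  interpret M: prob_space "mu p" by (rule prob_space_mu)
  let ?M = "{- int (n + r)..int (n + r)}" and ?N = "{- int n..int n}"
  let ?m = "\<integral>\<omega>. f \<omega> \<partial>mu p" and ?G = "genI ?N f"
  have sq: "x\<^sup>2 \<le> c\<^sup>2" if "\<bar>x\<bar> \<le> c" for x c :: real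
    using power_mono[OF that, of 2] by simp
  let ?q = "\<lambda>x. \<integral>\<omega>. (flip_gain x f \<omega>)\<^sup>2 \<partial>mu p"
  have loc: "local_fun f" using f(2) unfolding local_fun_def by blast
  note loc_intros = local_fun_intros local_fun_const local_fun_genI local_fun_flip_gain loc
  note int = local_fun_integrable_mu
  have "var p (step n \<epsilon> f) = (\<integral>\<omega>. (f \<omega> - ?m)\<^sup>2 + 2 * \<epsilon> * (f \<omega> * ?G \<omega>) - 2 * \<epsilon> * ?m * ?G \<omega> + \<epsilon>\<^sup>2 * (?G \<omega>)\<^sup>2 \<partial>mu p)"
    unfolding var_def integral_step[OF loc]
    by (intro Bochner_Integration.integral_cong) (auto simp: step_def power2_eq_square algebra_simps)
  also have "\<dots> = var p f + 2 * \<epsilon> * (\<integral>\<omega>. f \<omega> * ?G \<omega> \<partial>mu p) - 2 * \<epsilon> * ?m * (\<integral>\<omega>. ?G \<omega> \<partial>mu p) + \<epsilon>\<^sup>2 * (\<integral>\<omega>. (?G \<omega>)\<^sup>2 \<partial>mu p)"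
  proof -
    have "integrable (mu p) (\<lambda>\<omega>. (f \<omega> - ?m)\<^sup>2)" "integrable (mu p) (\<lambda>\<omega>. f \<omega> * ?G \<omega>)"
      "integrable (mu p) ?G" "integrable (mu p) (\<lambda>\<omega>. (?G \<omega>)\<^sup>2)"
      by (intro int loc_intros)+
    then show ?thesis by (simp add: var_def)
  qed
  also have "(\<integral>\<omega>. ?G \<omega> \<partial>mu p) = 0" by (rule integral_genI[OF loc])
  also have "(\<integral>\<omega>. f \<omega> * ?G \<omega> \<partial>mu p) = - (\<Sum>x\<in>?N. ?q x)" by (rule integral_mult_genI[OF loc])
  \<comment> \<open>The gap inequality needs the energy of the whole window \<open>?M\<close>, while
    the step only dissipates on \<open>?N\<close>; the shell in between becomes an error
    term.\<close>
  also have "(\<Sum>x\<in>?N. ?q x) = (\<Sum>x\<in>?M. ?q x) - (\<Sum>x\<in>?M - ?N. ?q x)"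
    by (subst sum_diff) auto
  finally have eq: "var p (step n \<epsilon> f) = var p f - 2 * \<epsilon> * ((\<Sum>x\<in>?M. ?q x) - (\<Sum>x\<in>?M - ?N. ?q x)) + \<epsilon>\<^sup>2 * (\<integral>\<omega>. (?G \<omega>)\<^sup>2 \<partial>mu p)"
    by (simp add: algebra_simps)
  have "(\<Sum>x\<in>?M - ?N. ?q x) \<le> (\<Sum>x\<in>?M - ?N. (D * exp (- real n))\<^sup>2)"
  proof (rule sum_mono)
    fix x assume x: "x \<in> ?M - ?N"
    have "?q x \<le> (\<integral>\<omega>. (D * exp (- real n))\<^sup>2 \<partial>mu p)"
      by (intro integral_mono int loc_intros sq boundary_flip_gain[OF f(1) x])
    then show "?q x \<le> (D * exp (- real n))\<^sup>2" by simp
  qed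
  also have "\<dots> = 2 * real r * (D * exp (- real n))\<^sup>2"
    by (simp only: sum_constant boundary_card)
  finally have b1: "(\<Sum>x\<in>?M - ?N. ?q x) \<le> 2 * real r * (D * exp (- real n))\<^sup>2" .
  have b2: "g * var p f \<le> (\<Sum>x\<in>?M. ?q x)"
    by (rule spectral_gap_local[OF loc f(2) _ g]) simp
  have "(\<integral>\<omega>. (?G \<omega>)\<^sup>2 \<partial>mu p) \<le> (\<integral>\<omega>. (real (2 * n + 1) * (2 * B))\<^sup>2 \<partial>mu p)"
  proof (intro integral_mono int loc_intros)
    fix \<omega>
    have "real (card ?N) = real (2 * n + 1)" by simp
    then have "\<bar>?G \<omega>\<bar> \<le> real (2 * n + 1) * (2 * B)"
      using abs_genI_le[of f B ?N \<omega>, OF f(3)] by metis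
    then show "(?G \<omega>)\<^sup>2 \<le> (real (2 * n + 1) * (2 * B))\<^sup>2"
      by (rule sq)
  qed
  then have b3: "(\<integral>\<omega>. (?G \<omega>)\<^sup>2 \<partial>mu p) \<le> (real (2 * n + 1) * (2 * B))\<^sup>2"
    by simp
  have "var p f - 2 * \<epsilon> * ((\<Sum>x\<in>?M. ?q x) - (\<Sum>x\<in>?M - ?N. ?q x)) + \<epsilon>\<^sup>2 * (\<integral>\<omega>. (?G \<omega>)\<^sup>2 \<partial>mu p)
     \<le> var p f - 2 * \<epsilon> * (g * var p f - 2 * real r * (D * exp (- real n))\<^sup>2) + \<epsilon>\<^sup>2 * (real (2 * n + 1) * (2 * B))\<^sup>2"
    using \<epsilon> b1 b2 b3 by (intro add_mono diff_mono mult_left_mono) auto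
  then show ?thesis unfolding eq by (simp add: algebra_simps power2_eq_square)
qed

section \<open>Iterated Euler steps\<close>

lemma osc_le_mono: "osc_le f D \<Longrightarrow> D \<le> D' \<Longrightarrow> osc_le f D'"
  unfolding osc_le_def
  by (meson exp_ge_zero mult_right_mono order.trans)

lemma iterate_depends_on:
  "depends_on f {- int (n + r)..int (n + r)} \<Longrightarrow>
    depends_on ((step n \<epsilon> ^^ k) f) {- int (n + r)..int (n + r)}"
  by (induction k) (simp_all add: step_depends_on del: of_nat_add)

lemma iterate_local: "local_fun f \<Longrightarrow> local_fun ((step n \<epsilon> ^^ k) f)"
  by (induction k) (simp_all add: step_local)

lemma iterate_integral:
  "local_fun f \<Longrightarrow> (\<integral>\<omega>. (step n \<epsilon> ^^ k) f \<omega> \<partial>mu p) = (\<integral>\<omega>. f \<omega> \<partial>mu p)"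
  by (induction k) (simp_all add: integral_step iterate_local)

lemma iterate_bounded:
  assumes "\<And>\<omega>. \<bar>f \<omega>\<bar> \<le> B" "0 \<le> \<epsilon>" "\<epsilon> * real (2 * n + 1) \<le> 1"
  shows "\<bar>(step n \<epsilon> ^^ k) f \<omega>\<bar> \<le> B"
proof (induction k arbitrary: \<omega>)
  case (Suc k)
  show ?case unfolding funpow.simps o_apply by (rule step_bounded[OF Suc assms(2,3)])
qed (simp add: assms(1))

text \<open>From \<open>1 + x \<le> exp x\<close>; the exponent contains only the elapsed time
  \<open>k * \<epsilon>\<close>, so the bound survives refining the step.\<close>

lemma iterate_osc:
  assumes "osc_le f D" "0 \<le> \<epsilon>" "\<epsilon> * real (2 * n + 1) \<le> 1"
  shows "osc_le ((step n \<epsilon> ^^ k) f) (D * exp (speed * (real k * \<epsilon>)))"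
proof (induction k)
  case (Suc k)
  have "1 + \<epsilon> * speed \<le> exp (\<epsilon> * speed)" by (rule exp_ge_add_one_self)
  then have "D * exp (speed * (real k * \<epsilon>)) * (1 + \<epsilon> * speed)
      \<le> D * exp (speed * (real k * \<epsilon>)) * exp (\<epsilon> * speed)"
    using osc_le_nonneg[OF assms(1)] by (intro mult_left_mono) auto
  also have "\<dots> = D * exp (speed * (real (Suc k) * \<epsilon>))"
    by (simp add: exp_add[symmetric] algebra_simps)
  finally show ?case
    using osc_le_mono[OF step_osc[OF Suc assms(2,3)]] by simp
qed (simp add: assms(1))

text \<open>A discrete Gronwall argument. The factor \<open>1 - 2 * \<epsilon> * g\<close> is
  bounded by an exponential on the initial variance, but only by 1 on the accumulated errors, which
  therefore grow linearly in time. The bound \<open>\<kappa>\<close> stands for the second-order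
  terms.\<close>

lemma iterate_var_le:
  assumes f: "depends_on f {- int (n + r)..int (n + r)}" "\<And>\<omega>. \<bar>f \<omega>\<bar> \<le> B"
    and osc: "\<And>i. i < k \<Longrightarrow> osc_le ((step n \<epsilon> ^^ i) f) D"
    and g: "ereal g \<le> gap p A" "0 \<le> g"
    and \<epsilon>: "0 \<le> \<epsilon>" "\<epsilon> * real (2 * n + 1) \<le> 1" "2 * \<epsilon> * g \<le> 1"
      "\<epsilon> * (real (2 * n + 1) * (2 * B))\<^sup>2 \<le> \<kappa>"
  shows "var p ((step n \<epsilon> ^^ k) f) \<le>
    exp (- (2 * g * (real k * \<epsilon>))) * var p f + real k * \<epsilon> * (4 * real r * (D * exp (- real n))\<^sup>2 + \<kappa>)"
  using osc
proof (induction k)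
  case (Suc k)
  let ?u = "(step n \<epsilon> ^^ k) f" and ?b = "4 * real r * (D * exp (- real n))\<^sup>2 + \<kappa>"
  let ?a = "1 - 2 * \<epsilon> * g"
  have u: "depends_on ?u {- int (n + r)..int (n + r)}" "\<And>\<omega>. \<bar>?u \<omega>\<bar> \<le> B"
    by (rule iterate_depends_on[OF f(1)], rule iterate_bounded[OF f(2) \<epsilon>(1,2)])
  have "0 \<le> \<epsilon> * (real (2 * n + 1) * (2 * B))\<^sup>2" using \<epsilon>(1) by simp
  then have \<kappa>: "0 \<le> \<kappa>" using \<epsilon>(4) by linarith
  then have b: "0 \<le> ?b" by simp
  have a: "0 \<le> ?a" "?a \<le> 1" using \<epsilon> g(2) by auto
  have var: "0 \<le> var p f" by (simp add: var_def)
  have IH: "var p ?u \<le> exp (- (2 * g * (real k * \<epsilon>))) * var p f + real k * \<epsilon> * ?b"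
    using Suc by simp
  have "var p (step n \<epsilon> ?u) \<le> ?a * var p ?u +
      \<epsilon> * (4 * real r * (D * exp (- real n))\<^sup>2 + \<epsilon> * (real (2 * n + 1) * (2 * B))\<^sup>2)"
    by (rule var_step_le[OF Suc.prems[OF lessI] u g(1) \<epsilon>(1)])
  also have "\<dots> \<le> ?a * var p ?u + \<epsilon> * ?b"
    using \<epsilon>(1,4) by (intro add_left_mono mult_left_mono) auto
  also have "\<dots> \<le> ?a * (exp (- (2 * g * (real k * \<epsilon>))) * var p f + real k * \<epsilon> * ?b) + \<epsilon> * ?b"
    by (rule add_right_mono[OF mult_left_mono[OF IH a(1)]])
  also have "\<dots> = ?a * (exp (- (2 * g * (real k * \<epsilon>))) * var p f) + ?a * (real k * \<epsilon> * ?b) + \<epsilon> * ?b"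
    by (simp only: distrib_left)
  also have "\<dots> \<le> exp (- (2 * g * \<epsilon>)) * (exp (- (2 * g * (real k * \<epsilon>))) * var p f) + 1 * (real k * \<epsilon> * ?b) + \<epsilon> * ?b"
  proof (intro add_mono mult_right_mono order_refl)
    show "?a \<le> exp (- (2 * g * \<epsilon>))"
      using exp_ge_add_one_self[of "- (2 * g * \<epsilon>)"] by (simp add: mult_ac)
  qed (use a b \<epsilon>(1) var in auto)
  also have "\<dots> = exp (- (2 * g * (real (Suc k) * \<epsilon>))) * var p f + real (Suc k) * \<epsilon> * ?b"
  proof -
    have "exp (- (2 * g * \<epsilon>)) * exp (- (2 * g * (real k * \<epsilon>))) = exp (- (2 * g * (real (Suc k) * \<epsilon>)))"
      by (simp add: exp_add[symmetric] algebra_simps)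
    then show ?thesis by (simp add: mult.assoc[symmetric] distrib_right)
  qed
  finally show ?case by simp
qed simp

end

section \<open>The semigroup of the process\<close>

locale kcsm_process = kcsm +
  fixes W :: "'w measure" and Pr :: "config \<Rightarrow> 'w measure" and X :: "real \<Rightarrow> 'w \<Rightarrow> config"
  assumes generated: "process_generated_by p A W Pr X"
begin

abbreviation "S \<equiv> expect Pr X"

text \<open>The Markov property is assumed on exactly this class. \<open>S t\<close> stays in it
  (\<open>S_bounded_meas\<close>), so the semigroup law can be iterated.\<close>

definition bounded_meas :: "(config \<Rightarrow> real) \<Rightarrow> bool" where
  "bounded_meas f \<longleftrightarrow> f \<in> borel_measurable Omega \<and> bounded (range f)"

lemma bounded_measI: "f \<in> borel_measurable Omega \<Longrightarrow> (\<And>\<omega>. \<bar>f \<omega>\<bar> \<le> B) \<Longrightarrow> bounded_meas f"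
  unfolding bounded_meas_def bounded_iff by auto

lemma bounded_measE:
  assumes "bounded_meas f"
  obtains B where "\<And>\<omega>. \<bar>f \<omega>\<bar> \<le> B"
  using assms unfolding bounded_meas_def bounded_iff by auto

lemma bounded_meas_diff:
  assumes "bounded_meas f" "bounded_meas g"
  shows "bounded_meas (\<lambda>\<omega>. f \<omega> - g \<omega>)"
proof -
  obtain B C where "\<And>\<omega>. \<bar>f \<omega>\<bar> \<le> B" "\<And>\<omega>. \<bar>g \<omega>\<bar> \<le> C"
    using bounded_measE[OF assms(1)] bounded_measE[OF assms(2)] by metis
  then have "\<bar>f \<omega> - g \<omega>\<bar> \<le> B + C" for \<omega>
    by (intro order.trans[OF abs_triangle_ineq4] add_mono)
  then show ?thesis
    using assms unfolding bounded_meas_def[of f] bounded_meas_def[of g]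
    by (intro bounded_measI borel_measurable_diff) auto
qed

lemma local_fun_bounded_meas: "local_fun f \<Longrightarrow> bounded_meas f"
  using local_fun_measurable local_fun_bounded bounded_measI by metis

lemma markov: "markov_process W Pr X"
  using generated by (simp add: process_generated_by_def)

lemma Pr_measurable: "Pr \<in> Omega \<rightarrow>\<^sub>M prob_algebra W"
  using markov by (simp add: markov_process_def)

lemma prob_space_Pr: "prob_space (Pr \<eta>)" and sets_Pr: "sets (Pr \<eta>) = sets W"
  using measurable_space[OF Pr_measurable, of \<eta>] by (auto simp: space_prob_algebra)

lemma X_measurable_W: "0 \<le> t \<Longrightarrow> X t \<in> W \<rightarrow>\<^sub>M Omega"
  using markov by (simp add: markov_process_def)

lemma X_measurable: "0 \<le> t \<Longrightarrow> X t \<in> Pr \<eta> \<rightarrow>\<^sub>M Omega"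
  using X_measurable_W sets_Pr by (simp cong: measurable_cong_sets)

lemma X_0: "AE w in Pr \<eta>. X 0 w = \<eta>"
  using markov by (simp add: markov_process_def)

lemma integrable_X:
  assumes "bounded_meas f" "0 \<le> t"
  shows "integrable (Pr \<eta>) (\<lambda>w. f (X t w))"
proof -
  interpret prob_space "Pr \<eta>" by (rule prob_space_Pr)
  obtain B where "\<And>\<omega>. \<bar>f \<omega>\<bar> \<le> B" using bounded_measE[OF assms(1)] by metis
  then show ?thesis
    using measurable_compose[OF X_measurable[OF assms(2)], of f borel \<eta>] assms(1)
    by (intro integrable_const_bound[where B = B]) (auto simp: bounded_meas_def)
qed

lemma S_abs_le:
  assumes "bounded_meas f" "0 \<le> t" "\<And>\<omega>. \<bar>f \<omega>\<bar> \<le> B"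
  shows "\<bar>S t f \<eta>\<bar> \<le> B"
proof -
  interpret prob_space "Pr \<eta>" by (rule prob_space_Pr)
  have "\<bar>S t f \<eta>\<bar> \<le> (\<integral>w. \<bar>f (X t w)\<bar> \<partial>Pr \<eta>)"
    unfolding expect_def by (rule integral_abs_bound)
  also have "\<dots> \<le> (\<integral>w. B \<partial>Pr \<eta>)"
    by (rule integral_mono[OF integrable_abs[OF integrable_X[OF assms(1,2)]]]) (simp_all add: assms(3))
  finally show ?thesis by (simp add: prob_space)
qed

lemma S_bounded_meas:
  assumes "bounded_meas f" "0 \<le> t"
  shows "bounded_meas (S t f)"
proof -
  obtain B where "\<And>\<omega>. \<bar>f \<omega>\<bar> \<le> B" using bounded_measE[OF assms(1)] by metis
  then have "\<bar>S t f \<eta>\<bar> \<le> B" for \<eta> by (rule S_abs_le[OF assms])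
  moreover have "S t f \<in> borel_measurable Omega"
    unfolding expect_def[abs_def]
  proof (rule measurable_compose[OF measurable_prob_algebraD[OF Pr_measurable]
        integral_measurable_subprob_algebra])
    show "(\<lambda>w. f (X t w)) \<in> borel_measurable W"
      using measurable_compose[OF X_measurable_W[OF assms(2)], of f borel] assms(1)
      by (simp add: bounded_meas_def)
  qed
  ultimately show ?thesis by (rule bounded_measI[rotated])
qed

lemma S_diff:
  assumes "bounded_meas f" "bounded_meas g" "0 \<le> t"
  shows "S t (\<lambda>\<omega>. f \<omega> - g \<omega>) \<eta> = S t f \<eta> - S t g \<eta>"
  unfolding expect_def by (intro Bochner_Integration.integral_diff integrable_X assms)

lemma S_linear:
  assumes "\<And>\<sigma>. \<sigma> \<in> P \<Longrightarrow> bounded_meas (e \<sigma>)" "0 \<le> t"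
  shows "S t (\<lambda>\<omega>. \<Sum>\<sigma>\<in>P. c \<sigma> * e \<sigma> \<omega>) \<eta> = (\<Sum>\<sigma>\<in>P. c \<sigma> * S t (e \<sigma>) \<eta>)"
proof -
  have "integrable (Pr \<eta>) (\<lambda>w. c \<sigma> * e \<sigma> (X t w))" if "\<sigma> \<in> P" for \<sigma>
    using integrable_X[OF assms(1)[OF that] assms(2)] by simp
  then show ?thesis
    unfolding expect_def by (simp add: Bochner_Integration.integral_sum)
qed

lemma S_0:
  assumes "bounded_meas f"
  shows "S 0 f \<eta> = f \<eta>"
proof -
  interpret prob_space "Pr \<eta>" by (rule prob_space_Pr)
  have "S 0 f \<eta> = (\<integral>w. f \<eta> \<partial>Pr \<eta>)"
    unfolding expect_def using X_0[of \<eta>] integrable_X[OF assms, of 0 \<eta>]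
    by (intro integral_cong_AE) auto
  then show ?thesis by (simp add: prob_space)
qed

text \<open>Integrate the Markov property: conditioning on the past up to time \<open>s\<close> does
  not change the expectation.\<close>

lemma S_add:
  assumes f: "bounded_meas f" and t: "0 \<le> s" "0 \<le> t"
  shows "S (s + t) f \<eta> = S s (S t f) \<eta>"
proof -
  interpret prob_space "Pr \<eta>" by (rule prob_space_Pr)
  let ?F = "past W X s"
  have "subalgebra (Pr \<eta>) ?F"
    unfolding subalgebra_def
  proof
    let ?G = "\<Union>u\<in>{0..s}. {X u -` B \<inter> space W | B. B \<in> sets Omega}"
    have pow: "?G \<subseteq> Pow (space W)" and sub: "?G \<subseteq> sets W"
      using measurable_sets[OF X_measurable_W] by auto
    have "space (Pr \<eta>) = space W" by (rule sets_eq_imp_space_eq[OF sets_Pr])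
    then show "space ?F = space (Pr \<eta>)"
      by (simp only: past_def space_measure_of[OF pow])
    show "sets ?F \<subseteq> sets (Pr \<eta>)"
      unfolding past_def sets_Pr sets_measure_of[OF pow] by (rule sets.sigma_sets_subset[OF sub])
  qed
  then interpret finite_measure_subalgebra "Pr \<eta>" ?F
    by unfold_locales
  have ae: "AE w in Pr \<eta>. real_cond_exp (Pr \<eta>) ?F (\<lambda>w. f (X (s + t) w)) w = S t f (X s w)"
    using markov f t unfolding markov_process_def bounded_meas_def by blast
  have "S (s + t) f \<eta> = (\<integral>w. real_cond_exp (Pr \<eta>) ?F (\<lambda>w. f (X (s + t) w)) w \<partial>Pr \<eta>)"
    unfolding expect_def using real_cond_exp_int(2)[OF integrable_X[OF f, of "s + t" \<eta>]] t by simp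
  also have "\<dots> = (\<integral>w. S t f (X s w) \<partial>Pr \<eta>)"
    using real_cond_exp_int(1)[OF integrable_X[OF f, of "s + t" \<eta>]]
      integrable_X[OF S_bounded_meas[OF f t(2)] t(1), of \<eta>] t ae
    by (intro integral_cong_AE) auto
  finally show ?thesis by (simp add: expect_def)
qed

section \<open>Comparison of the semigroup with Euler steps\<close>

lemma S_generator:
  assumes "local_fun f"
  shows "uniform_limit UNIV (\<lambda>t \<eta>. (S t f \<eta> - f \<eta>) / t) (gen p A f) (at_right 0)"
proof -
  \<comment> \<open>The constant sequence \<open>f\<close> witnesses membership in the closure,
    whose graph is by assumption that of the semigroup generator.\<close>
  have "C_gen p A f (gen p A f)"
    unfolding C_gen_def using assms by (auto intro!: exI[of _ "\<lambda>_. f"] uniform_limit_const)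
  then have "semigroup_gen S f (gen p A f)"
    using generated unfolding process_generated_by_def by blast
  then show ?thesis by (simp add: semigroup_gen_def)
qed

text \<open>
  The first-order error is uniform over the functions of norm at most \<open>B\<close> on a finite window,
  because these are bounded combinations of finitely many pattern indicators.
\<close>

lemma euler_remainder:
  assumes "finite I" "0 < \<delta>"
  obtains \<epsilon>\<^sub>0 where "0 < \<epsilon>\<^sub>0"
    "\<And>\<epsilon> f B \<eta>. 0 < \<epsilon> \<Longrightarrow> \<epsilon> < \<epsilon>\<^sub>0 \<Longrightarrow> depends_on f I \<Longrightarrow> (\<And>\<omega>. \<bar>f \<omega>\<bar> \<le> B) \<Longrightarrow>
       \<bar>S \<epsilon> f \<eta> - f \<eta> - \<epsilon> * gen p A f \<eta>\<bar> \<le> \<epsilon> * (\<delta> * B)"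
proof -
  let ?N = "real (card (Pow I))"
  let ?e = "\<lambda>\<sigma>. indicator (pattern I \<sigma>) :: config \<Rightarrow> real"
  have fin: "finite (Pow I)" using assms(1) by simp
  then have N: "0 < ?N" by (auto simp: card_gt_0_iff)
  have loc: "local_fun (?e \<sigma>)" for \<sigma>
    using depends_on_pattern assms(1) unfolding local_fun_def by blast
  \<comment> \<open>The tolerance is divided by the number of patterns because the errors of all
    patterns will be added.\<close>
  have "\<forall>\<^sub>F \<epsilon> in at_right 0. \<forall>\<eta>\<in>UNIV. dist ((S \<epsilon> (?e \<sigma>) \<eta> - ?e \<sigma> \<eta>) / \<epsilon>) (gen p A (?e \<sigma>) \<eta>) < \<delta> / ?N" for \<sigma>
    by (rule uniform_limitD[OF S_generator[OF loc]]) (use assms(2) N in simp)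
  then have "\<forall>\<^sub>F \<epsilon> in at_right 0. \<forall>\<sigma>\<in>Pow I. \<forall>\<eta>\<in>UNIV. dist ((S \<epsilon> (?e \<sigma>) \<eta> - ?e \<sigma> \<eta>) / \<epsilon>) (gen p A (?e \<sigma>) \<eta>) < \<delta> / ?N"
    by (intro eventually_ball_finite[OF fin] ballI)
  then obtain \<epsilon>\<^sub>0 where \<epsilon>\<^sub>0: "0 < \<epsilon>\<^sub>0" and small: "\<And>\<epsilon> \<sigma> \<eta>. 0 < \<epsilon> \<Longrightarrow> \<epsilon> < \<epsilon>\<^sub>0 \<Longrightarrow> \<sigma> \<in> Pow I \<Longrightarrow>
      dist ((S \<epsilon> (?e \<sigma>) \<eta> - ?e \<sigma> \<eta>) / \<epsilon>) (gen p A (?e \<sigma>) \<eta>) < \<delta> / ?N"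
    unfolding eventually_at_right_field by auto
  show ?thesis
  proof (rule that[OF \<epsilon>\<^sub>0])
    fix \<epsilon> B :: real and f :: "config \<Rightarrow> real" and \<eta> :: config
    assume \<epsilon>: "0 < \<epsilon>" "\<epsilon> < \<epsilon>\<^sub>0" and f: "depends_on f I" "\<And>\<omega>. \<bar>f \<omega>\<bar> \<le> B"
    let ?c = "\<lambda>\<sigma>. f (\<lambda>x. x \<in> \<sigma>)"
    let ?R = "\<lambda>\<sigma>. S \<epsilon> (?e \<sigma>) \<eta> - ?e \<sigma> \<eta> - \<epsilon> * genI I (?e \<sigma>) \<eta>"
    have exp: "f = (\<lambda>\<omega>. \<Sum>\<sigma>\<in>Pow I. ?c \<sigma> * ?e \<sigma> \<omega>)"
      by (rule ext) (rule depends_on_expand[OF f(1) assms(1)])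
    have S: "S \<epsilon> f \<eta> = (\<Sum>\<sigma>\<in>Pow I. ?c \<sigma> * S \<epsilon> (?e \<sigma>) \<eta>)"
      by (subst exp, rule S_linear) (use loc local_fun_bounded_meas \<epsilon> in auto)
    have G: "genI I f \<eta> = (\<Sum>\<sigma>\<in>Pow I. ?c \<sigma> * genI I (?e \<sigma>) \<eta>)"
      by (subst exp, rule genI_linear)
    have F: "f \<eta> = (\<Sum>\<sigma>\<in>Pow I. ?c \<sigma> * ?e \<sigma> \<eta>)"
      by (rule depends_on_expand[OF f(1) assms(1)])
    have eq: "S \<epsilon> f \<eta> - f \<eta> - \<epsilon> * gen p A f \<eta> = (\<Sum>\<sigma>\<in>Pow I. ?c \<sigma> * ?R \<sigma>)"
      unfolding gen_eq_genI[OF f(1) assms(1)] S G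
      by (subst F) (simp add: sum_subtractf sum.distrib sum_distrib_left algebra_simps)
    have R: "\<bar>?R \<sigma>\<bar> \<le> \<epsilon> * (\<delta> / ?N)" if "\<sigma> \<in> Pow I" for \<sigma>
    proof -
      have "gen p A (?e \<sigma>) \<eta> = genI I (?e \<sigma>) \<eta>"
        by (rule gen_eq_genI[OF depends_on_pattern assms(1)])
      then have "\<bar>(S \<epsilon> (?e \<sigma>) \<eta> - ?e \<sigma> \<eta>) / \<epsilon> - genI I (?e \<sigma>) \<eta>\<bar> \<le> \<delta> / ?N"
        using small[OF \<epsilon> that, of \<eta>] unfolding dist_real_def by linarith
      then have "\<epsilon> * \<bar>(S \<epsilon> (?e \<sigma>) \<eta> - ?e \<sigma> \<eta>) / \<epsilon> - genI I (?e \<sigma>) \<eta>\<bar> \<le> \<epsilon> * (\<delta> / ?N)"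
        using \<epsilon>(1) by (intro mult_left_mono) auto
      moreover have "?R \<sigma> = \<epsilon> * ((S \<epsilon> (?e \<sigma>) \<eta> - ?e \<sigma> \<eta>) / \<epsilon> - genI I (?e \<sigma>) \<eta>)"
        using \<epsilon>(1) by (subst right_diff_distrib) simp
      ultimately show ?thesis using \<epsilon>(1) by (simp only: abs_mult abs_of_pos)
    qed
    have "\<bar>?c \<sigma> * ?R \<sigma>\<bar> \<le> B * (\<epsilon> * (\<delta> / ?N))" if "\<sigma> \<in> Pow I" for \<sigma>
      unfolding abs_mult using f(2)[of "\<lambda>_. True"] by (intro mult_mono f(2) R that) auto
    then have "\<bar>\<Sum>\<sigma>\<in>Pow I. ?c \<sigma> * ?R \<sigma>\<bar> \<le> (\<Sum>\<sigma>\<in>Pow I. B * (\<epsilon> * (\<delta> / ?N)))"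
      by (rule order.trans[OF sum_abs sum_mono])
    then show "\<bar>S \<epsilon> f \<eta> - f \<eta> - \<epsilon> * gen p A f \<eta>\<bar> \<le> \<epsilon> * (\<delta> * B)"
      unfolding eq sum_constant using N by (simp add: mult_ac)
  qed
qed

text \<open>The semigroup contracts the supremum norm, so an error once made is not amplified. Each
  step adds only the first-order remainder and the boundary term.\<close>

lemma euler_error:
  assumes f: "depends_on f {- int (n + r)..int (n + r)}" "\<And>\<omega>. \<bar>f \<omega>\<bar> \<le> B"
    and osc: "\<And>i. i < k \<Longrightarrow> osc_le ((step n \<epsilon> ^^ i) f) D"
    and \<epsilon>: "0 \<le> \<epsilon>" "\<epsilon> * real (2 * n + 1) \<le> 1"
    and rem: "\<And>h \<eta>. depends_on h {- int (n + r)..int (n + r)} \<Longrightarrow> (\<And>\<omega>. \<bar>h \<omega>\<bar> \<le> B) \<Longrightarrow>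
      \<bar>S \<epsilon> h \<eta> - h \<eta> - \<epsilon> * gen p A h \<eta>\<bar> \<le> \<epsilon> * \<kappa>"
  shows "\<bar>S (real k * \<epsilon>) f \<eta> - (step n \<epsilon> ^^ k) f \<eta>\<bar> \<le>
    real k * \<epsilon> * (\<kappa> + 2 * real r * (D * exp (- real n)))"
  using osc
proof (induction k arbitrary: \<eta>)
  case 0
  have "local_fun f" using f(1) unfolding local_fun_def by blast
  then show ?case by (simp add: S_0 local_fun_bounded_meas)
next
  case (Suc k)
  let ?u = "(step n \<epsilon> ^^ k) f" and ?c = "\<kappa> + 2 * real r * (D * exp (- real n))"
  let ?v = "S (real k * \<epsilon>) f"
  have loc: "local_fun f" using f(1) unfolding local_fun_def by blast
  have bm: "bounded_meas f" "bounded_meas ?u"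
    using local_fun_bounded_meas iterate_local loc by blast+
  have k: "0 \<le> real k * \<epsilon>" using \<epsilon>(1) by simp
  have u: "depends_on ?u {- int (n + r)..int (n + r)}" "\<And>\<omega>. \<bar>?u \<omega>\<bar> \<le> B"
    by (rule iterate_depends_on[OF f(1)], rule iterate_bounded[OF f(2) \<epsilon>])
  have IH: "\<bar>?v \<eta> - ?u \<eta>\<bar> \<le> real k * \<epsilon> * ?c" for \<eta>
    by (rule Suc.IH) (use Suc.prems in simp)
  have "S (real (Suc k) * \<epsilon>) f \<eta> = S \<epsilon> ?v \<eta>"
    using S_add[OF bm(1) \<epsilon>(1) k] by (simp add: algebra_simps)
  \<comment> \<open>Telescoping: the previous error transported by the semigroup, the remainder of
    one exact step, and the cost of cutting off the generator.\<close>
  then have split: "S (real (Suc k) * \<epsilon>) f \<eta> - step n \<epsilon> ?u \<eta> =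
      S \<epsilon> (\<lambda>\<omega>. ?v \<omega> - ?u \<omega>) \<eta> + (S \<epsilon> ?u \<eta> - ?u \<eta> - \<epsilon> * gen p A ?u \<eta>)
      + \<epsilon> * (gen p A ?u \<eta> - genI {- int n..int n} ?u \<eta>)"
    unfolding S_diff[OF S_bounded_meas[OF bm(1) k] bm(2) \<epsilon>(1)]
    by (simp add: step_def algebra_simps)
  have 1: "\<bar>S \<epsilon> (\<lambda>\<omega>. ?v \<omega> - ?u \<omega>) \<eta>\<bar> \<le> real k * \<epsilon> * ?c"
    by (rule S_abs_le[OF bounded_meas_diff[OF S_bounded_meas[OF bm(1) k] bm(2)] \<epsilon>(1) IH])
  have 2: "\<bar>S \<epsilon> ?u \<eta> - ?u \<eta> - \<epsilon> * gen p A ?u \<eta>\<bar> \<le> \<epsilon> * \<kappa>"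
    by (rule rem[OF u])
  have "\<bar>gen p A ?u \<eta> - genI {- int n..int n} ?u \<eta>\<bar> \<le> 2 * real r * (D * exp (- real n))"
    by (rule gen_minus_genI_le[OF Suc.prems[OF lessI] u(1)])
  then have 3: "\<bar>\<epsilon> * (gen p A ?u \<eta> - genI {- int n..int n} ?u \<eta>)\<bar> \<le> \<epsilon> * (2 * real r * (D * exp (- real n)))"
    unfolding abs_mult abs_of_nonneg[OF \<epsilon>(1)] using \<epsilon>(1) by (rule mult_left_mono)
  have "\<bar>S (real (Suc k) * \<epsilon>) f \<eta> - step n \<epsilon> ?u \<eta>\<bar>
      \<le> real k * \<epsilon> * ?c + \<epsilon> * \<kappa> + \<epsilon> * (2 * real r * (D * exp (- real n)))"
    unfolding split
    by (rule order.trans[OF abs_triangle_ineq add_mono[OF order.trans[OF abs_triangle_ineq add_mono[OF 1 2]] 3]])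
  also have "\<dots> = real (Suc k) * \<epsilon> * ?c" by (simp add: algebra_simps)
  finally show ?case by simp
qed

text \<open>Take \<open>k\<close> Euler steps of length \<open>t / k\<close>. The tolerance
  \<open>\<kappa>\<close> absorbs everything that vanishes as \<open>k\<close> grows; what is left
  is \<open>E\<close>, the bound on the oscillation at the edge of the box up to time
  \<open>t\<close>.\<close>

lemma local_approximation:
  assumes f: "depends_on f {- int n..int n}" "\<And>\<omega>. \<bar>f \<omega>\<bar> \<le> B" "osc_le f D"
    and t: "0 < t" and \<kappa>: "0 < \<kappa>" and g: "ereal g \<le> gap p A" "0 \<le> g"
  defines "E \<equiv> D * exp (speed * t) * exp (- real n)"
  obtains h where "depends_on h {- int (n + r)..int (n + r)}"
    "(\<integral>\<omega>. h \<omega> \<partial>mu p) = (\<integral>\<omega>. f \<omega> \<partial>mu p)"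
    "\<And>\<eta>. \<bar>S t f \<eta> - h \<eta>\<bar> \<le> t * (\<kappa> + 2 * real r * E)"
    "var p h \<le> exp (- (2 * g * t)) * var p f + t * (4 * real r * E\<^sup>2 + \<kappa>)"
proof -
  let ?I = "{- int (n + r)..int (n + r)}"
  have f': "depends_on f ?I" by (rule depends_on_mono[OF f(1)]) auto
  have loc: "local_fun f" using f(1) unfolding local_fun_def by blast
  have B: "0 \<le> B" using f(2)[of "\<lambda>_. True"] by linarith
  let ?Q = "(real (2 * n + 1) * (2 * B))\<^sup>2"
  \<comment> \<open>Adding 1 keeps the quotient meaningful for \<open>B = 0\<close>; multiplied by
    \<open>B\<close> it still stays below \<open>\<kappa>\<close>.\<close>
  have \<delta>: "0 < \<kappa> / (B + 1)" using \<kappa> B by simp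
  obtain \<epsilon>\<^sub>0 where \<epsilon>\<^sub>0: "0 < \<epsilon>\<^sub>0" and rem:
    "\<And>\<epsilon> h C \<eta>. 0 < \<epsilon> \<Longrightarrow> \<epsilon> < \<epsilon>\<^sub>0 \<Longrightarrow> depends_on h ?I \<Longrightarrow> (\<And>\<omega>. \<bar>h \<omega>\<bar> \<le> C) \<Longrightarrow>
       \<bar>S \<epsilon> h \<eta> - h \<eta> - \<epsilon> * gen p A h \<eta>\<bar> \<le> \<epsilon> * (\<kappa> / (B + 1) * C)"
  proof (rule euler_remainder[OF finite_atLeastAtMost_int \<delta>])
    fix \<epsilon>\<^sub>0
    assume "0 < \<epsilon>\<^sub>0" and "\<And>\<epsilon> h C \<eta>. 0 < \<epsilon> \<Longrightarrow> \<epsilon> < \<epsilon>\<^sub>0 \<Longrightarrow> depends_on h ?I \<Longrightarrow> (\<And>\<omega>. \<bar>h \<omega>\<bar> \<le> C) \<Longrightarrow>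
       \<bar>S \<epsilon> h \<eta> - h \<eta> - \<epsilon> * gen p A h \<eta>\<bar> \<le> \<epsilon> * (\<kappa> / (B + 1) * C)"
    then show ?thesis by (rule that)
  qed
  \<comment> \<open>The four summands yield, in order, the smallness conditions \<open>e1\<close> to
    \<open>e4\<close> on \<open>\<epsilon>\<close>.\<close>
  obtain k :: nat where k: "t / \<epsilon>\<^sub>0 + t * real (2 * n + 1) + 2 * t * g + t * ?Q / \<kappa> < real k"
    using reals_Archimedean2 by blast
  have pos: "0 < t / \<epsilon>\<^sub>0" "0 \<le> t * real (2 * n + 1)" "0 \<le> 2 * t * g" "0 \<le> t * ?Q / \<kappa>"
    using t \<epsilon>\<^sub>0 g(2) \<kappa> by auto
  have k0: "0 < real k" using k pos by linarith
  define \<epsilon> where "\<epsilon> = t / real k"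
  have \<epsilon>: "0 < \<epsilon>" and t_eq: "real k * \<epsilon> = t" using t k0 by (auto simp: \<epsilon>_def)
  have e1: "\<epsilon> < \<epsilon>\<^sub>0"
  proof -
    have "t / \<epsilon>\<^sub>0 < real k" using k pos by linarith
    then show ?thesis using \<epsilon>\<^sub>0 k0 by (simp add: \<epsilon>_def field_simps)
  qed
  have e2: "\<epsilon> * real (2 * n + 1) \<le> 1"
  proof -
    have "t * real (2 * n + 1) \<le> real k" using k pos by linarith
    then show ?thesis using k0 unfolding \<epsilon>_def times_divide_eq_left by (subst divide_le_eq_1_pos) auto
  qed
  have e3: "2 * \<epsilon> * g \<le> 1"
  proof -
    have "2 * t * g \<le> real k" using k pos by linarith
    then show ?thesis using k0 by (simp add: \<epsilon>_def)
  qed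
  have e4: "\<epsilon> * ?Q \<le> \<kappa>"
  proof -
    have "t * ?Q / \<kappa> \<le> real k" using k pos by linarith
    then have "t * ?Q \<le> real k * \<kappa>" using \<kappa> by (simp only: pos_divide_le_eq)
    then show ?thesis
      using k0 unfolding \<epsilon>_def times_divide_eq_left by (subst pos_divide_le_eq) (simp_all only: mult.commute)
  qed
  let ?D = "D * exp (speed * t)"
  have osc: "osc_le ((step n \<epsilon> ^^ i) f) ?D" if "i < k" for i
  proof (rule osc_le_mono[OF iterate_osc[OF f(3)]])
    have "real i * \<epsilon> \<le> real k * \<epsilon>" using that \<epsilon> by (intro mult_right_mono) auto
    then have "speed * (real i * \<epsilon>) \<le> speed * t"
      unfolding t_eq by (rule mult_left_mono[OF _ speed_nonneg])
    then show "D * exp (speed * (real i * \<epsilon>)) \<le> ?D"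
      using osc_le_nonneg[OF f(3)] by (intro mult_left_mono) auto
  qed (use \<epsilon> e2 in auto)
  have \<kappa>': "\<kappa> / (B + 1) * B \<le> \<kappa>"
    using B \<kappa> by (simp add: divide_le_eq mult_left_mono)
  have rem': "\<bar>S \<epsilon> h \<eta> - h \<eta> - \<epsilon> * gen p A h \<eta>\<bar> \<le> \<epsilon> * \<kappa>"
    if "depends_on h ?I" "\<And>\<omega>. \<bar>h \<omega>\<bar> \<le> B" for h \<eta>
    using rem[OF \<epsilon> e1 that, of \<eta>] mult_left_mono[OF \<kappa>', of \<epsilon>] \<epsilon> by linarith
  show thesis
  proof (rule that)
    show "depends_on ((step n \<epsilon> ^^ k) f) ?I" by (rule iterate_depends_on[OF f'])
    show "(\<integral>\<omega>. (step n \<epsilon> ^^ k) f \<omega> \<partial>mu p) = (\<integral>\<omega>. f \<omega> \<partial>mu p)" by (rule iterate_integral[OF loc])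
    show "\<bar>S t f \<eta> - (step n \<epsilon> ^^ k) f \<eta>\<bar> \<le> t * (\<kappa> + 2 * real r * E)" for \<eta>
      using euler_error[OF f' f(2) osc less_imp_le[OF \<epsilon>] e2 rem', of k \<eta>] unfolding t_eq E_def .
    show "var p ((step n \<epsilon> ^^ k) f) \<le> exp (- (2 * g * t)) * var p f + t * (4 * real r * E\<^sup>2 + \<kappa>)"
      using iterate_var_le[where k = k, OF f' f(2) osc g less_imp_le[OF \<epsilon>] e2 e3 e4] unfolding t_eq E_def .
  qed
qed

end

section \<open>Change of the initial measure\<close>

text \<open>Positivity gives the quotient in the assumption on \<open>\<nu>\<close> its meaning:
  division by zero would yield 0 and bound nothing.\<close>

lemma measure_cylinder_pos:
  assumes "0 < p" "p < 1"
  shows "0 < measure (mu p) (cylinder l \<omega>)"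
proof -
  let ?B = "measure_pmf (bernoulli_pmf p)" and ?J = "{- int l..int l}"
  interpret M: prob_space "mu p" by (rule prob_space_mu)
  have eq: "cylinder l \<omega> = prod_emb UNIV (\<lambda>_. ?B) ?J (\<Pi>\<^sub>E x\<in>?J. {\<omega> x})"
    by (rule set_eqI) (simp add: cylinder_def prod_emb_def PiE_iff)
  have "emeasure (mu p) (cylinder l \<omega>) = (\<Prod>x\<in>?J. emeasure ?B {\<omega> x})"
    unfolding mu_def eq by (rule emeasure_PiM_emb) (simp_all add: measure_pmf.prob_space_axioms)
  also have "\<dots> \<noteq> 0"
  proof -
    have "pmf (bernoulli_pmf p) b \<noteq> 0" for b using assms by (cases b) simp_all
    then show ?thesis by (simp add: emeasure_pmf_single)
  qed
  finally show ?thesis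
    unfolding M.emeasure_eq_measure by (simp add: zero_less_measure_iff)
qed

lemma cylinder_ratio_bound:
  fixes lam :: real
  assumes p: "0 < p" "p < 1"
    and sup: "(SUP l::nat. ennreal (MAX \<omega>\<in>{- int l..int l} \<rightarrow>\<^sub>E UNIV.
         exp (- lam * real l) * (measure \<nu> (cylinder l \<omega>) / measure (mu p) (cylinder l \<omega>)))) < \<infinity>"
  obtains C where "0 \<le> C"
    "\<And>l \<omega>. measure \<nu> (cylinder l \<omega>) \<le> C * exp (lam * real l) * measure (mu p) (cylinder l \<omega>)"
proof -
  let ?q = "\<lambda>l \<omega>. exp (- lam * real l) * (measure \<nu> (cylinder l \<omega>) / measure (mu p) (cylinder l \<omega>))"
  let ?P = "\<lambda>l. {- int l..int l} \<rightarrow>\<^sub>E (UNIV :: bool set)"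
  let ?s = "SUP l::nat. ennreal (Max (?q l ` ?P l))"
  define C where "C = enn2real ?s"
  have C: "ennreal C = ?s" using sup by (simp add: C_def)
  have "measure \<nu> (cylinder l \<omega>) \<le> C * exp (lam * real l) * measure (mu p) (cylinder l \<omega>)" for l \<omega>
  proof -
    \<comment> \<open>The maximum runs over extensional functions on the box; restricting
      \<open>\<omega>\<close> produces one of them with the same cylinder.\<close>
    let ?\<omega> = "restrict \<omega> {- int l..int l}"
    have cyl: "cylinder l ?\<omega> = cylinder l \<omega>" by (auto simp: cylinder_def)
    have "finite (?P l)" by (intro finite_PiE) auto
    then have "?q l ?\<omega> \<le> Max (?q l ` ?P l)"
      by (intro Max_ge finite_imageI imageI) auto
    also have "ennreal (Max (?q l ` ?P l)) \<le> ennreal C"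
      unfolding C by (rule SUP_upper) simp
    then have "Max (?q l ` ?P l) \<le> C"
      by (subst (asm) ennreal_le_iff) (simp_all add: C_def)
    finally have "?q l \<omega> \<le> C" by (simp only: cyl)
    then show ?thesis
      using measure_cylinder_pos[OF p, of l \<omega>] by (simp add: exp_minus field_simps)
  qed
  then show ?thesis by (rule that[rotated]) (simp add: C_def)
qed

text \<open>A nonnegative function of the window is a nonnegative combination of indicators of
  cylinders, so the bound on cylinders can be summed.\<close>

lemma integral_le_of_cylinder_ratio:
  assumes h: "depends_on h {- int l..int l}" "\<And>\<omega>. 0 \<le> h \<omega>"
    and \<nu>: "prob_space \<nu>" "sets \<nu> = sets Omega"
    and ratio: "\<And>\<omega>. measure \<nu> (cylinder l \<omega>) \<le> c * measure (mu p) (cylinder l \<omega>)"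
  shows "(\<integral>\<omega>. h \<omega> \<partial>\<nu>) \<le> c * (\<integral>\<omega>. h \<omega> \<partial>mu p)"
proof -
  let ?I = "{- int l..int l}"
  have cyl: "pattern ?I \<sigma> = cylinder l (\<lambda>x. x \<in> \<sigma>)" if "\<sigma> \<in> Pow ?I" for \<sigma>
    using that unfolding pattern_def cylinder_def by blast
  have expand: "(\<integral>\<omega>. h \<omega> \<partial>N) = (\<Sum>\<sigma>\<in>Pow ?I. h (\<lambda>x. x \<in> \<sigma>) * measure N (pattern ?I \<sigma>))"
    if N: "prob_space N" "sets N = sets Omega" for N
  proof -
    interpret prob_space N by fact
    have pat: "pattern ?I \<sigma> \<in> sets N" for \<sigma> using pattern_sets N(2) by simp
    have "(\<integral>\<omega>. h \<omega> \<partial>N) = (\<integral>\<omega>. (\<Sum>\<sigma>\<in>Pow ?I. h (\<lambda>x. x \<in> \<sigma>) * indicator (pattern ?I \<sigma>) \<omega>) \<partial>N)"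
      by (rule Bochner_Integration.integral_cong[OF refl]) (rule depends_on_expand[OF h(1) finite_atLeastAtMost_int])
    also have "\<dots> = (\<Sum>\<sigma>\<in>Pow ?I. \<integral>\<omega>. h (\<lambda>x. x \<in> \<sigma>) * indicator (pattern ?I \<sigma>) \<omega> \<partial>N)"
      using pat by (intro Bochner_Integration.integral_sum integrable_mult_right) (simp add: emeasure_eq_measure)
    also have "\<dots> = (\<Sum>\<sigma>\<in>Pow ?I. h (\<lambda>x. x \<in> \<sigma>) * measure N (pattern ?I \<sigma>))"
      using pat by simp
    finally show ?thesis .
  qed
  have "(\<integral>\<omega>. h \<omega> \<partial>\<nu>) = (\<Sum>\<sigma>\<in>Pow ?I. h (\<lambda>x. x \<in> \<sigma>) * measure \<nu> (pattern ?I \<sigma>))"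
    by (rule expand[OF \<nu>])
  also have "\<dots> \<le> (\<Sum>\<sigma>\<in>Pow ?I. h (\<lambda>x. x \<in> \<sigma>) * (c * measure (mu p) (pattern ?I \<sigma>)))"
    by (intro sum_mono mult_left_mono h(2)) (simp add: cyl ratio)
  also have "\<dots> = c * (\<integral>\<omega>. h \<omega> \<partial>mu p)"
    unfolding expand[OF prob_space_mu sets_mu] sum_distrib_left by (simp only: mult_ac)
  finally show ?thesis .
qed

text \<open>The arithmetic-geometric mean inequality stands in for Cauchy-Schwarz; \<open>s\<close>
  is free and will be chosen of the order of the expected standard deviation.\<close>

lemma integral_abs_diff_mean_le:
  assumes h: "local_fun h" and s: "0 < s"
  shows "(\<integral>\<omega>. \<bar>h \<omega> - (\<integral>\<eta>. h \<eta> \<partial>mu p)\<bar> \<partial>mu p) \<le> (var p h / s + s) / 2"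
proof -
  let ?Y = "\<lambda>\<omega>. h \<omega> - (\<integral>\<eta>. h \<eta> \<partial>mu p)"
  have Y: "local_fun ?Y" by (intro local_fun_diff h local_fun_const)
  have sq: "integrable (mu p) (\<lambda>\<omega>. (?Y \<omega>)\<^sup>2)"
    by (rule local_fun_integrable_mu[OF local_fun_power[OF Y]])
  have pw: "\<bar>a\<bar> \<le> (a\<^sup>2 / s + s) / 2" for a :: real
  proof -
    have "0 \<le> (\<bar>a\<bar> - s)\<^sup>2" by simp
    then have "2 * \<bar>a\<bar> * s \<le> a\<^sup>2 + s\<^sup>2" by (simp add: power2_diff)
    then show ?thesis using s by (simp add: field_simps power2_eq_square)
  qed
  have "(\<integral>\<omega>. \<bar>?Y \<omega>\<bar> \<partial>mu p) \<le> (\<integral>\<omega>. ((?Y \<omega>)\<^sup>2 / s + s) / 2 \<partial>mu p)"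
  proof (rule integral_mono)
    show "integrable (mu p) (\<lambda>\<omega>. \<bar>?Y \<omega>\<bar>)"
      by (rule local_fun_integrable_mu[OF local_fun_abs[OF Y]])
    show "integrable (mu p) (\<lambda>\<omega>. ((?Y \<omega>)\<^sup>2 / s + s) / 2)"
      by (rule local_fun_integrable_mu) (rule local_fun_compose[OF Y])
  qed (rule pw)
  also have "\<dots> = (var p h / s + s) / 2"
  proof -
    have "integrable (mu p) (\<lambda>\<omega>. s)" by (rule local_fun_integrable_mu) simp
    then show ?thesis using sq by (simp add: var_def)
  qed
  finally show ?thesis .
qed

section \<open>Exponential decay under the initial measure \<nu>\<close>

context kcsm_process
begin

text \<open>Under \<open>mu p\<close> the approximation is within \<open>exp (- (g * t))\<close> of
  its mean in L1, up to a constant. Passing to \<nu> costs \<open>exp (g / 2 * t)\<close> by the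
  choice of \<open>lam\<close>, which leaves the rate \<open>g / 2\<close>. The assumption
  \<open>g \<le> 1\<close> makes all approximation errors decay at least as fast.\<close>

lemma exponential_decay:
  fixes lam g :: real
  assumes g: "ereal g \<le> gap p A" "0 < g" "g \<le> 1"
    and \<nu>: "prob_space \<nu>" "sets \<nu> = sets Omega"
    and lam: "lam = g / (2 * (speed + 2))"
    and ratio: "0 \<le> C" "\<And>l \<omega>. measure \<nu> (cylinder l \<omega>) \<le> C * exp (lam * real l) * measure (mu p) (cylinder l \<omega>)"
    and f: "local_fun f"
  shows "\<exists>C'. \<forall>t>0. (\<integral>\<eta>. \<bar>S t f \<eta> - (\<integral>\<omega>. f \<omega> \<partial>mu p)\<bar> \<partial>\<nu>) \<le> C' * exp (- (g / 2) * t)"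
proof -
  interpret N: prob_space \<nu> by fact
  let ?m = "\<integral>\<omega>. f \<omega> \<partial>mu p" and ?K = "speed + 2"
  have K: "0 < ?K" using speed_nonneg by linarith
  obtain B where B: "\<And>\<omega>. \<bar>f \<omega>\<bar> \<le> B" using local_fun_bounded[OF f] by metis
  obtain I where I: "finite I" "depends_on f I" using f unfolding local_fun_def by blast
  \<comment> \<open>The sum dominates each distance and, unlike a maximum, needs no separate case
    for empty \<open>I\<close>.\<close>
  define n\<^sub>0 where "n\<^sub>0 = (\<Sum>x\<in>I. nat \<bar>x\<bar>)"
  have I_sub: "I \<subseteq> {- int n\<^sub>0..int n\<^sub>0}"
  proof
    fix x assume "x \<in> I"
    then have "nat \<bar>x\<bar> \<le> n\<^sub>0" unfolding n\<^sub>0_def using I(1) by (intro member_le_sum) auto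
    then show "x \<in> {- int n\<^sub>0..int n\<^sub>0}" by auto
  qed
  define D where "D = 2 * B * exp (real n\<^sub>0)"
  have D: "osc_le f D"
    unfolding D_def by (rule osc_le_local[OF depends_on_mono[OF I(2) I_sub] B])
  \<comment> \<open>\<open>Q\<close> collects the initial variance and the variance errors,
    \<open>a\<close> the errors in supremum norm, and \<open>b\<close> the L1 bound after the change
    of measure.\<close>
  define Q where "Q = var p f + 1 + 4 * real r * D\<^sup>2"
  define a where "a = 1 + 2 * real r * D"
  define b where "b = C * exp (lam * (real n\<^sub>0 + real r + 1)) * ((Q + 1) / 2)"
  have V: "0 \<le> var p f" by (simp add: var_def)
  have Q: "0 \<le> Q" using V by (simp add: Q_def)
  have a: "0 \<le> a" using osc_le_nonneg[OF D] by (simp add: a_def)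
  have lam0: "0 \<le> lam" using g(2) K by (simp add: lam)
  have "(\<integral>\<eta>. \<bar>S t f \<eta> - ?m\<bar> \<partial>\<nu>) \<le> (a + b) * exp (- (g / 2) * t)" if t: "0 < t" for t
  proof -
    \<comment> \<open>With \<open>n \<ge> (speed + 2) * t\<close> the boundary factor
      \<open>exp (speed * t - n)\<close> is at most \<open>exp (- 2 * t)\<close>. Rounding up costs
      at most 1, which is the \<open>+ 1\<close> in \<open>b\<close>.\<close>
    define n where "n = n\<^sub>0 + nat \<lceil>?K * t\<rceil>"
    have Kt: "0 < ?K * t" using K t by simp
    have n: "?K * t \<le> real n" "real n \<le> real n\<^sub>0 + ?K * t + 1"
      unfolding n_def using Kt by linarith+
    have f_n: "depends_on f {- int n..int n}"
      by (rule depends_on_mono[OF depends_on_mono[OF I(2) I_sub]]) (auto simp: n_def)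
    let ?E = "D * exp (speed * t) * exp (- real n)"
    have E0: "0 \<le> ?E" using osc_le_nonneg[OF D] by simp
    have E: "?E \<le> D * exp (- 2 * t)"
    proof -
      have "exp (speed * t) * exp (- real n) \<le> exp (- 2 * t)"
        using n(1) by (simp add: exp_add[symmetric] algebra_simps)
      then show ?thesis using osc_le_nonneg[OF D] by (simp only: mult.assoc mult_left_mono)
    qed
    have t_exp: "t * exp (- t) \<le> 1"
    proof -
      have "t \<le> exp t" using exp_ge_add_one_self[of t] by linarith
      then show ?thesis by (simp add: exp_minus field_simps)
    qed
    \<comment> \<open>The tolerance is taken as \<open>exp (- 4 * t)\<close>, the order of the
      square of \<open>?E\<close>.\<close>
    obtain h where h: "depends_on h {- int (n + r)..int (n + r)}"
      and mean: "(\<integral>\<omega>. h \<omega> \<partial>mu p) = ?m"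
      and err: "\<And>\<eta>. \<bar>S t f \<eta> - h \<eta>\<bar> \<le> t * (exp (- 4 * t) + 2 * real r * ?E)"
      and var_h: "var p h \<le> exp (- (2 * g * t)) * var p f + t * (4 * real r * ?E\<^sup>2 + exp (- 4 * t))"
      using local_approximation[OF f_n B D t exp_gt_zero g(1) less_imp_le[OF g(2)]] by blast
    have h_loc: "local_fun h" using h unfolding local_fun_def by blast
    have err': "\<bar>S t f \<eta> - h \<eta>\<bar> \<le> a * exp (- (g / 2) * t)" for \<eta>
    proof -
      have "exp (- 4 * t) + 2 * real r * ?E \<le> exp (- 2 * t) + 2 * real r * (D * exp (- 2 * t))"
        using t E by (intro add_mono mult_left_mono) auto
      also have "\<dots> = a * exp (- 2 * t)" by (simp add: a_def algebra_simps)
      finally have "t * (exp (- 4 * t) + 2 * real r * ?E) \<le> t * (a * exp (- 2 * t))"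
        using t by (intro mult_left_mono) auto
      \<comment> \<open>One factor \<open>exp (- t)\<close> is spent on the linear factor
        \<open>t\<close>.\<close>
      also have "\<dots> = a * exp (- t) * (t * exp (- t))"
        by (simp add: exp_add[symmetric] algebra_simps)
      also have "\<dots> \<le> a * exp (- t) * 1"
        using a t_exp by (intro mult_left_mono) auto
      also have "\<dots> \<le> a * exp (- (g / 2) * t)"
        using a g t by simp (intro mult_left_mono, auto)
      finally show ?thesis using err[of \<eta>] by linarith
    qed
    have "var p h \<le> exp (- (2 * g * t)) * Q"
    proof -
      have "?E\<^sup>2 \<le> (D * exp (- 2 * t))\<^sup>2" using E E0 by (rule power_mono)
      also have "\<dots> = D\<^sup>2 * exp (- 4 * t)"
        by (simp add: power_mult_distrib exp_double[symmetric])
      finally have "4 * real r * ?E\<^sup>2 + exp (- 4 * t) \<le> 4 * real r * (D\<^sup>2 * exp (- 4 * t)) + exp (- 4 * t)"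
        by (intro add_right_mono mult_left_mono) auto
      also have "\<dots> = (1 + 4 * real r * D\<^sup>2) * exp (- 4 * t)" by (simp add: algebra_simps)
      finally have "t * (4 * real r * ?E\<^sup>2 + exp (- 4 * t)) \<le> t * ((1 + 4 * real r * D\<^sup>2) * exp (- 4 * t))"
        using t by (intro mult_left_mono) auto
      also have "\<dots> = (1 + 4 * real r * D\<^sup>2) * exp (- 3 * t) * (t * exp (- t))"
        by (simp add: exp_add[symmetric] algebra_simps)
      also have "\<dots> \<le> (1 + 4 * real r * D\<^sup>2) * exp (- 3 * t) * 1"
        using t_exp by (intro mult_left_mono) auto
      also have "\<dots> \<le> (1 + 4 * real r * D\<^sup>2) * exp (- (2 * g * t))"
      proof -
        have "g * t \<le> 1 * t" using g(3) t by (intro mult_right_mono) auto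
        then have "exp (- 3 * t) \<le> exp (- (2 * g * t))" using t by simp
        then show ?thesis by (simp add: mult_left_mono)
      qed
      finally show ?thesis using var_h by (simp add: Q_def algebra_simps)
    qed
    \<comment> \<open>Preparation for \<open>s = exp (- (g * t))\<close>, which balances the two
      terms of the L1 estimate.\<close>
    then have var_ratio: "var p h / exp (- (g * t)) \<le> Q * exp (- (g * t))"
      by (simp add: pos_divide_le_eq exp_add[symmetric] mult_ac)
    have "(\<integral>\<omega>. \<bar>h \<omega> - ?m\<bar> \<partial>mu p) \<le> (var p h / exp (- (g * t)) + exp (- (g * t))) / 2"
      using integral_abs_diff_mean_le[OF h_loc, of "exp (- (g * t))" p] unfolding mean by simp
    also have "\<dots> \<le> (Q + 1) / 2 * exp (- (g * t))"
      using var_ratio by (simp add: field_simps)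
    finally have L1: "(\<integral>\<omega>. \<bar>h \<omega> - ?m\<bar> \<partial>mu p) \<le> (Q + 1) / 2 * exp (- (g * t))" .
    have "(\<integral>\<omega>. \<bar>h \<omega> - ?m\<bar> \<partial>\<nu>) \<le> C * exp (lam * real (n + r)) * (\<integral>\<omega>. \<bar>h \<omega> - ?m\<bar> \<partial>mu p)"
      by (rule integral_le_of_cylinder_ratio[OF _ _ \<nu> ratio(2)])
        (use depends_on_compose[OF h, of "\<lambda>u. \<bar>u - ?m\<bar>"] in auto)
    also have "\<dots> \<le> C * exp (lam * real (n + r)) * ((Q + 1) / 2 * exp (- (g * t)))"
      using L1 ratio(1) by (intro mult_left_mono) auto
    \<comment> \<open>By the choice of \<open>lam\<close>, its product with \<open>?K * t\<close> is
      exactly \<open>g / 2 * t\<close>; the remaining part of \<open>n + r\<close> does not depend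
      on \<open>t\<close>.\<close>
    also have "\<dots> \<le> C * (exp (lam * (real n\<^sub>0 + real r + 1)) * exp (g / 2 * t)) * ((Q + 1) / 2 * exp (- (g * t)))"
    proof (intro mult_right_mono mult_left_mono)
      have "g / (2 * c) * (c * t) = g / 2 * t" if "0 < c" for c
        using that by simp
      from this[OF K] have "lam * (?K * t) = g / 2 * t" unfolding lam .
      moreover have "lam * real (n + r) \<le> lam * ((real n\<^sub>0 + real r + 1) + ?K * t)"
        using n(2) lam0 by (intro mult_left_mono) auto
      ultimately have "lam * real (n + r) \<le> lam * (real n\<^sub>0 + real r + 1) + g / 2 * t"
        by (simp only: distrib_left)
      then show "exp (lam * real (n + r)) \<le> exp (lam * (real n\<^sub>0 + real r + 1)) * exp (g / 2 * t)"
        by (simp only: exp_add[symmetric] exp_le_cancel_iff)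
    qed (use ratio(1) Q in auto)
    also have "\<dots> = b * (exp (g / 2 * t) * exp (- (g * t)))"
      by (simp add: b_def)
    also have "exp (g / 2 * t) * exp (- (g * t)) = exp (- (g / 2) * t)"
      by (simp add: exp_add[symmetric])
    finally have L2: "(\<integral>\<omega>. \<bar>h \<omega> - ?m\<bar> \<partial>\<nu>) \<le> b * exp (- (g / 2) * t)" .
    have int: "integrable \<nu> (\<lambda>\<omega>. \<bar>h \<omega> - ?m\<bar>)"
      by (rule local_fun_integrable[OF local_fun_compose[OF h_loc] N.finite_measure_axioms \<nu>(2)])
    have "(\<integral>\<eta>. \<bar>S t f \<eta> - ?m\<bar> \<partial>\<nu>) \<le> (\<integral>\<eta>. a * exp (- (g / 2) * t) + \<bar>h \<eta> - ?m\<bar> \<partial>\<nu>)"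
    \<comment> \<open>This rule takes integrability and nonnegativity of the upper bound; the latter
      covers the default value 0 of a Bochner integral.\<close>
    proof (rule integral_mono')
      show "integrable \<nu> (\<lambda>\<eta>. a * exp (- (g / 2) * t) + \<bar>h \<eta> - ?m\<bar>)"
        using int by simp
      show "\<bar>S t f \<eta> - ?m\<bar> \<le> a * exp (- (g / 2) * t) + \<bar>h \<eta> - ?m\<bar>" for \<eta>
        using err'[of \<eta>] by linarith
      show "0 \<le> a * exp (- (g / 2) * t) + \<bar>h \<eta> - ?m\<bar>" for \<eta>
        using a by simp
    qed
    also have "\<dots> = a * exp (- (g / 2) * t) + (\<integral>\<eta>. \<bar>h \<eta> - ?m\<bar> \<partial>\<nu>)"
      using int by (simp add: N.prob_space)
    also have "\<dots> \<le> (a + b) * exp (- (g / 2) * t)"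
      using L2 by (simp add: algebra_simps)
    finally show ?thesis .
  qed
  then show ?thesis by blast
qed

end

theorem theorem2p1:
  fixes p :: real and r :: nat and A :: "int \<Rightarrow> config set"
  assumes "0 < p" and "p < 1"
    and "kcsm_constraints r A"
    and "gap p A > 0"
  shows "\<exists>lam>0. \<exists>m>0. \<forall>(W :: 'w measure) Pr X. process_generated_by p A W Pr X \<longrightarrow>
    (\<forall>\<nu> :: config measure. prob_space \<nu> \<longrightarrow> sets \<nu> = sets Omega \<longrightarrow>
      (SUP l::nat. ennreal (MAX \<omega>\<in>{- int l..int l} \<rightarrow>\<^sub>E UNIV.
         exp (- lam * real l) * (measure \<nu> (cylinder l \<omega>) / measure (mu p) (cylinder l \<omega>)))) < \<infinity> \<longrightarrow>
      (\<forall>f. local_fun f \<longrightarrow>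
        (\<exists>C::real. \<forall>t>0.
          (\<integral>\<eta>. \<bar>expect Pr X t f \<eta> - (\<integral>\<omega>. f \<omega> \<partial>mu p)\<bar> \<partial>\<nu>) \<le> C * exp (- m * t))))"
proof -
  interpret kcsm p r A by (rule kcsm.intro) fact+
  \<comment> \<open>The gap is an extended real, so a positive real below it is picked, and cut at 1
    because the approximation errors decay at a fixed rate.\<close>
  obtain g where g: "ereal g \<le> gap p A" "0 < g" "g \<le> 1"
  proof -
    obtain q where q: "0 < ereal q" "ereal q < gap p A"
      using ereal_dense2[OF assms(4)] by blast
    have "ereal (min q 1) \<le> ereal q" by (subst ereal_less_eq) simp
    also have "\<dots> \<le> gap p A" by (rule less_imp_le[OF q(2)])
    finally show thesis using q(1) by (intro that[of "min q 1"]) (simp_all del: ereal_min)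
  qed
  \<comment> \<open>This involves only \<open>g\<close> and \<open>speed\<close>, so it is fixed
    before the process, \<nu> and \<open>f\<close>.\<close>
  define lam where "lam = g / (2 * (speed + 2))"
  have lam: "0 < lam" using g(2) speed_nonneg by (simp add: lam_def)
  show ?thesis
  proof (rule exI[of _ lam], rule conjI[OF lam], rule exI[of _ "g / 2"], rule conjI,
      goal_cases positive decay)
    case positive
    show ?case using g(2) by simp
  next
    case decay
    show ?case
    proof (intro allI impI)
      fix W :: "'w measure" and Pr X \<nu> f
      assume gen: "process_generated_by p A W Pr X" and \<nu>: "prob_space \<nu>" "sets \<nu> = sets Omega"
        and sup: "(SUP l::nat. ennreal (MAX \<omega>\<in>{- int l..int l} \<rightarrow>\<^sub>E UNIV.
          exp (- lam * real l) * (measure \<nu> (cylinder l \<omega>) / measure (mu p) (cylinder l \<omega>)))) < \<infinity>"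
        and f: "local_fun f"
      interpret kcsm_process p r A W Pr X
        by unfold_locales (rule gen)
      obtain C where C: "0 \<le> C"
        "\<And>l \<omega>. measure \<nu> (cylinder l \<omega>) \<le> C * exp (lam * real l) * measure (mu p) (cylinder l \<omega>)"
        using cylinder_ratio_bound[OF assms(1,2) sup] by blast
      show "\<exists>C. \<forall>t>0. (\<integral>\<eta>. \<bar>expect Pr X t f \<eta> - (\<integral>\<omega>. f \<omega> \<partial>mu p)\<bar> \<partial>\<nu>) \<le> C * exp (- (g / 2) * t)"
        by (rule exponential_decay[OF g \<nu> lam_def C f])
    qed
  qed
qed

end
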